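(* There exists an absolute constant $L>0$ (independent of $K$, $N$ and $\alpha$) such that for all integers $K\geq 2$ and $N\geq 1$ and all real $\alpha\geq L$, $$ \mathbb{E} M_{N,\alpha} = - \frac{\alpha}{2^K} + \frac{\sqrt{\alpha}}{2^K}\, \mathbb{E} M_N + R(\alpha), \qquad\text{where } |R(\alpha)|\leq L\,\alpha^{1/3}. $$ Here $M_{N,\alpha}=\max_{\sigma\in\{-1,+1\}^N} H_\alpha(\sigma)/N$ is the normalized maximum of the random $K$-sat Hamiltonian $H_\alpha$ with parameters $K,N,\alpha$, and $M_N=\max_{\sigma\in\{-1,+1\}^N} H(\sigma)/N$ is the normalized maximum of the Gaussian mixed $p$-spin Hamiltonian $H$ with parameters $K,N$ (both defined in the context). The remainder $R(\alpha)$ may also depend on $N$ and $K$, but the bound on it is uniform in them.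
   Context: Let $K\geq 2$ and $N\geq 1$ be integers and $\alpha>0$ real. Elements of $\{-1,+1\}^N$ are denoted $\sigma=(\sigma_1,\ldots,\sigma_N)$. **$K$-sat Hamiltonian.** Let $(i_{j,k})_{j,k\geq 1}$ be i.i.d. random indices uniformly distributed on $\{1,\ldots,N\}$, let $\pi(\alpha N)$ be a Poisson random variable with mean $\alpha N$, and let $(\varepsilon_{j,k})_{j,k\geq 1}$ be i.i.d. random signs with $\mathbb{P}(\varepsilon_{j,k}=1)=\mathbb{P}(\varepsilon_{j,k}=-1)=1/2$; the family of indices, the Poisson variable and the family of signs are independent of each other. Define, for $\sigma\in\{-1,+1\}^N$, $$ H_{\alpha}(\sigma)=-\sum_{1\leq j\leq \pi(\alpha N)} \ \prod_{1\leq k\leq K} \frac{1+\varepsilon_{j,k}\, \sigma_{i_{j,k}}}{2} $$ (an empty sum is $0$), and $$ M_{N,\alpha} = \max_{\sigma\in\{-1,+1\}^N}\frac{H_{\alpha}(\sigma)}{N}. $$ Thus $-N M_{N,\alpha}$ is the smallest number of unsatisfied clauses over all assignments $\sigma$, where the $j$-th clause is unsatisfied by $\sigma$ if the $j$-th product equals $1$ and satisfied if it equals $0$. **Mixed $p$-spin Hamiltonian.** Let $g_{i_1,\ldots,i_p}$, for $1\leq p\leq K$ and $1\leq i_1,\ldots,i_p\leq N$, be standard Gaussian random variables, independent for all $p$ and all indices $(i_1,\ldots,i_p)$. Define, for $\sigma\in\{-1,+1\}^N$, $$ H(\sigma) = \sum_{p=1}^K \sqrt{\binom{K}{p} \frac{1}{N^{p-1}}}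 \sum_{1\leq i_1,\ldots,i_p\leq N}g_{i_1,\ldots,i_p}\, \sigma_{i_1}\cdots\sigma_{i_p}, \qquad M_N = \max_{\sigma\in\{-1,+1\}^N}\frac{H(\sigma)}{N}. $$ *)

theory Defs
  imports "HOL-Probability.Probability"
begin

definition spin_configs :: "nat \<Rightarrow> (nat \<Rightarrow> real) set" where
  "spin_configs N = {1..N} \<rightarrow>\<^sub>E {-1, 1}"

text \<open>
  A sample of the K-sat disorder is a triple \<open>(n, i, e)\<close>: the number of clauses, the indices
  \<open>i (j, k)\<close> and the signs \<open>e (j, k)\<close>. All random variables are realized as
  coordinates of product spaces, since the expectations depend only on their joint law.
\<close>

definition ksat_hamiltonian ::
  "nat \<Rightarrow> nat \<times> (nat \<times> nat \<Rightarrow> nat) \<times> (nat \<times> nat \<Rightarrow> real) \<Rightarrow> (nat \<Rightarrow> real) \<Rightarrow> real" where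
  "ksat_hamiltonian K = (\<lambda>(n, i, e) \<sigma>.
     - (\<Sum>j\<in>{1..n}. \<Prod>k\<in>{1..K}. (1 + e (j, k) * \<sigma> (i (j, k))) / 2))"

definition ksat_max ::
  "nat \<Rightarrow> nat \<Rightarrow> nat \<times> (nat \<times> nat \<Rightarrow> nat) \<times> (nat \<times> nat \<Rightarrow> real) \<Rightarrow> real" where
  "ksat_max K N \<omega> = (MAX \<sigma>\<in>spin_configs N. ksat_hamiltonian K \<omega> \<sigma> / real N)"

definition ksat_disorder ::
  "nat \<Rightarrow> real \<Rightarrow> (nat \<times> (nat \<times> nat \<Rightarrow> nat) \<times> (nat \<times> nat \<Rightarrow> real)) measure" where
  "ksat_disorder N \<alpha> =
     measure_pmf (poisson_pmf (\<alpha> * real N)) \<Otimes>\<^sub>M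
     ((\<Pi>\<^sub>M jk\<in>{1..} \<times> {1..}. measure_pmf (pmf_of_set {1..N})) \<Otimes>\<^sub>M
      (\<Pi>\<^sub>M jk\<in>{1..} \<times> {1..}. measure_pmf (pmf_of_set {-1, 1})))"

definition expected_ksat_max :: "nat \<Rightarrow> nat \<Rightarrow> real \<Rightarrow> real" where
  "expected_ksat_max K N \<alpha> = (\<integral>\<omega>. ksat_max K N \<omega> \<partial>ksat_disorder N \<alpha>)"

text \<open>Multi-indices \<open>(i\<^sub>1, \<dots>, i\<^sub>p)\<close> are lists of length \<open>p\<close>, so a single family indexed by
  lists contains the Gaussians for all \<open>p\<close>.\<close>

definition multi_indices :: "nat \<Rightarrow> nat \<Rightarrow> nat list set" where
  "multi_indices N p = {is. length is = p \<and> set is \<subseteq> {1..N}}"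

definition pspin_hamiltonian ::
  "nat \<Rightarrow> nat \<Rightarrow> (nat list \<Rightarrow> real) \<Rightarrow> (nat \<Rightarrow> real) \<Rightarrow> real" where
  "pspin_hamiltonian K N g \<sigma> =
     (\<Sum>p\<in>{1..K}. sqrt (real (K choose p) * (1 / real N ^ (p - 1))) *
        (\<Sum>is\<in>multi_indices N p. g is * prod_list (map \<sigma> is)))"

definition pspin_max :: "nat \<Rightarrow> nat \<Rightarrow> (nat list \<Rightarrow> real) \<Rightarrow> real" where
  "pspin_max K N g = (MAX \<sigma>\<in>spin_configs N. pspin_hamiltonian K N g \<sigma> / real N)"

definition pspin_disorder :: "nat \<Rightarrow> nat \<Rightarrow> (nat list \<Rightarrow> real) measure" where
  "pspin_disorder K N =
     (\<Pi>\<^sub>M is\<in>(\<Union>p\<in>{1..K}. multi_indices N p). std_normal_distribution)"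

definition expected_pspin_max :: "nat \<Rightarrow> nat \<Rightarrow> real" where
  "expected_pspin_max K N = (\<integral>g. pspin_max K N g \<partial>pspin_disorder K N)"

end

theory Submission
  imports Defs
begin

text \<open>
  Replace the maximum by the smooth maximum \<open>F x = ln (\<Sum>\<sigma>. exp (\<beta> x\<^sub>\<sigma>)) / \<beta>\<close>, at a cost of
  \<open>N ln 2 / \<beta>\<close>. The number of violated clauses is a compound Poisson vector, and its covariance
  \<open>\<alpha> N ((1 + R) / 4)\<^sup>K\<close>, where \<open>R\<close> is the overlap of two configurations, is that of
  \<open>\<surd>\<alpha> / 2\<^sup>K\<close> times the mixed \<open>p\<close>-spin Hamiltonian up to a constant, by the binomial theorem.
  Divide the time interval \<open>[0, 1]\<close> into \<open>n\<close> steps of length \<open>h\<close>. In one step the Poisson vector is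
  replaced by a Bernoulli mixture, which adds a single random clause with probability \<open>\<alpha> N h\<close>, and
  exchanging this for the Gaussian increment (Lindeberg's method) changes the mean of \<open>F\<close>, after
  centring, by at most \<open>4 \<beta>\<^sup>2 \<alpha> N h / 2\<^sup>K + O(h\<^bsup>3/2\<^esup>)\<close>. As \<open>n\<close> tends to infinity the Bernoulli
  mixtures converge to the Poisson law and the \<open>O(h\<^bsup>3/2\<^esup>)\<close> terms disappear. Balancing
  \<open>1 / \<beta>\<close> against \<open>\<alpha> \<beta>\<^sup>2\<close> gives \<open>\<beta> = \<alpha>\<^bsup>-1/3\<^esup>\<close>.
\<close>

section \<open>Smooth maximum\<close>

text \<open>The smooth maximum is log-sum-exp because adding a vector y to its argument changes it
  by the cumulant generating function of y under a Gibbs measure, so Gaussian increments and clauses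
  are both handled by cumulant expansions. Linear terms are harmless: the Gaussian one has mean
  zero, and every configuration violates a clause with probability \<open>1 / 2 ^ K\<close>, so the
  clause contributes a constant. Quadratic terms match by the covariance identity. The two
  remainders behave differently. A Gaussian increment shrinks with sqrt h, so its cubic error, whose
  constant depends on N and K, may be bounded crudely: it sums to order sqrt h. A clause has size 1
  however small h is; only its probability shrinks, so its cubic error survives the limit and needs
  an absolute constant. Its total carries a factor N, as does the smoothing cost N ln 2 / \<beta>,
  so division by N leaves bounds uniform in N. All one-step estimates are uniform in the starting
  vector of the smooth maximum, which lets one step be replaced inside the others.\<close>

lemma abs_ln_one_plus_cubic_bound:
  fixes a :: real
  assumes "\<bar>a\<bar> \<le> 1 / 2"
  shows "\<bar>ln (1 + a) - a + a\<^sup>2 / 2\<bar> \<le> 2 * \<bar>a\<bar> ^ 3"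
proof -
  define h where "h = (\<lambda>x::real. ln (1 + x) - x + x\<^sup>2 / 2)"
  \<comment> \<open>The derivative 1 / (1 + x) - 1 + x equals x^2 / (1 + x), so one mean value
    estimate already yields third order; 1 + x >= 1/2 supplies the factor 2.\<close>
  have deriv: "(h has_real_derivative (x\<^sup>2 / (1 + x))) (at x within {-\<bar>a\<bar>..\<bar>a\<bar>})"
    if "x \<in> {-\<bar>a\<bar>..\<bar>a\<bar>}" for x
  proof -
    have "1 + x > 0" using that assms by auto
    then show ?thesis
      unfolding h_def
      by (auto intro!: derivative_eq_intros simp: field_simps power2_eq_square)
  qed
  have bound: "norm (x\<^sup>2 / (1 + x)) \<le> 2 * \<bar>a\<bar>\<^sup>2" if "x \<in> {-\<bar>a\<bar>..\<bar>a\<bar>}" for x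
  proof -
    have "1 + x \<ge> 1 / 2" using that assms by auto
    moreover have "x\<^sup>2 \<le> \<bar>a\<bar>\<^sup>2" using that by (intro abs_le_square_iff[THEN iffD1]) auto
    ultimately have "x\<^sup>2 / (1 + x) \<le> \<bar>a\<bar>\<^sup>2 / (1 / 2)"
      by (intro frac_le) auto
    with \<open>1 + x \<ge> 1 / 2\<close> show ?thesis by simp
  qed
  have "norm (h a - h 0) \<le> 2 * \<bar>a\<bar>\<^sup>2 * norm (a - 0)"
    by (rule field_differentiable_bound[OF _ deriv bound]) auto
  then show ?thesis
    by (simp add: h_def power3_eq_cube power2_eq_square)
qed

lemma abs_exp_cubic_bound:
  fixes u :: real
  assumes "\<bar>u\<bar> \<le> 1 / 4"
  shows "\<bar>exp u - 1 - u - u\<^sup>2 / 2\<bar> \<le> \<bar>u\<bar> ^ 3"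
proof -
  obtain t where t: "\<bar>t\<bar> \<le> \<bar>u\<bar>" "exp u = (\<Sum>m<3. u ^ m / fact m) + exp t / fact 3 * u ^ 3"
    using Maclaurin_exp_le[of u 3] by blast
  have "exp t \<le> exp (1::real)" using t assms by simp
  also have "\<dots> \<le> 3" by (rule exp_le)
  finally have "exp t / 6 \<le> 1" by simp
  have "\<bar>exp u - 1 - u - u\<^sup>2 / 2\<bar> = exp t / 6 * \<bar>u\<bar> ^ 3"
    using t(2) by (simp add: eval_nat_numeral abs_mult)
  also have "\<dots> \<le> 1 * \<bar>u\<bar> ^ 3"
    using \<open>exp t / 6 \<le> 1\<close> by (intro mult_right_mono) auto
  finally show ?thesis by simp
qed

lemma log_laplace_bounded:
  fixes w u :: "'s \<Rightarrow> real"
  assumes S: "finite S" and w: "\<And>\<sigma>. \<sigma> \<in> S \<Longrightarrow> 0 \<le> w \<sigma>" "sum w S = 1"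
    and u: "\<And>\<sigma>. \<sigma> \<in> S \<Longrightarrow> \<bar>u \<sigma>\<bar> \<le> M"
  shows "\<bar>ln (\<Sum>\<sigma>\<in>S. w \<sigma> * exp (u \<sigma>))\<bar> \<le> M"
proof -
  have "(\<Sum>\<sigma>\<in>S. w \<sigma> * exp (u \<sigma>)) \<le> (\<Sum>\<sigma>\<in>S. w \<sigma> * exp M)"
    using u w by (intro sum_mono mult_left_mono) (auto simp: abs_le_iff)
  then have up: "(\<Sum>\<sigma>\<in>S. w \<sigma> * exp (u \<sigma>)) \<le> exp M"
    using w(2) by (simp add: sum_distrib_right[symmetric])
  have "- u \<sigma> \<le> M" if "\<sigma> \<in> S" for \<sigma> using u[OF that] by linarith
  then have "(\<Sum>\<sigma>\<in>S. w \<sigma> * exp (u \<sigma>)) \<ge> (\<Sum>\<sigma>\<in>S. w \<sigma> * exp (- M))"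
    using w by (intro sum_mono mult_left_mono) (auto simp: minus_le_iff)
  then have lo: "(\<Sum>\<sigma>\<in>S. w \<sigma> * exp (u \<sigma>)) \<ge> exp (- M)"
    using w(2) by (simp add: sum_distrib_right[symmetric])
  have pos: "0 < (\<Sum>\<sigma>\<in>S. w \<sigma> * exp (u \<sigma>))"
    using lo exp_gt_zero[of "- M"] by linarith
  have "ln (\<Sum>\<sigma>\<in>S. w \<sigma> * exp (u \<sigma>)) \<le> ln (exp M)"
    using up pos by (subst ln_le_cancel_iff) auto
  moreover have "ln (\<Sum>\<sigma>\<in>S. w \<sigma> * exp (u \<sigma>)) \<ge> ln (exp (- M))"
    using lo pos by (subst ln_le_cancel_iff) auto
  ultimately show ?thesis by simp
qed

lemma weighted_mean_bounded:
  fixes w u :: "'s \<Rightarrow> real"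
  assumes "\<And>\<sigma>. \<sigma> \<in> S \<Longrightarrow> 0 \<le> w \<sigma>" "sum w S = 1"
    and "\<And>\<sigma>. \<sigma> \<in> S \<Longrightarrow> \<bar>u \<sigma>\<bar> \<le> M"
  shows "\<bar>\<Sum>\<sigma>\<in>S. w \<sigma> * u \<sigma>\<bar> \<le> M"
proof -
  have "\<bar>\<Sum>\<sigma>\<in>S. w \<sigma> * u \<sigma>\<bar> \<le> (\<Sum>\<sigma>\<in>S. w \<sigma> * M)"
    using assms by (intro order_trans[OF sum_abs] sum_mono) (auto simp: abs_mult mult_left_mono)
  then show ?thesis using assms(2) by (simp add: sum_distrib_right[symmetric])
qed

text \<open>Cumulant expansion up to the variance, with an absolute constant and no smallness
  assumed of M: Gaussian increments are unbounded, so large exponents have to be covered as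
  well.\<close>

lemma log_laplace_second_order:
  fixes w u :: "'s \<Rightarrow> real"
  assumes S: "finite S" and w: "\<And>\<sigma>. \<sigma> \<in> S \<Longrightarrow> 0 \<le> w \<sigma>" "sum w S = 1"
    and u: "\<And>\<sigma>. \<sigma> \<in> S \<Longrightarrow> \<bar>u \<sigma>\<bar> \<le> M" and M: "0 \<le> M"
  shows "\<bar>ln (\<Sum>\<sigma>\<in>S. w \<sigma> * exp (u \<sigma>)) - (\<Sum>\<sigma>\<in>S. w \<sigma> * u \<sigma>)
    - ((\<Sum>\<sigma>\<in>S. w \<sigma> * (u \<sigma>)\<^sup>2) - (\<Sum>\<sigma>\<in>S. w \<sigma> * u \<sigma>)\<^sup>2) / 2\<bar> \<le> 100 * M ^ 3"
proof -
  define m1 m2 A where "m1 = (\<Sum>\<sigma>\<in>S. w \<sigma> * u \<sigma>)" and "m2 = (\<Sum>\<sigma>\<in>S. w \<sigma> * (u \<sigma>)\<^sup>2)"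
    and "A = (\<Sum>\<sigma>\<in>S. w \<sigma> * exp (u \<sigma>)) - 1"
  have m1: "\<bar>m1\<bar> \<le> M" unfolding m1_def by (rule weighted_mean_bounded[OF w u])
  have u2: "\<bar>(u \<sigma>)\<^sup>2\<bar> \<le> M\<^sup>2" if "\<sigma> \<in> S" for \<sigma>
    using u[OF that] M by (simp add: abs_le_square_iff[symmetric])
  have m2: "\<bar>m2\<bar> \<le> M\<^sup>2" unfolding m2_def by (rule weighted_mean_bounded[OF w u2])
  have m1sq: "m1\<^sup>2 \<le> M\<^sup>2" using m1 M by (simp add: abs_le_square_iff[symmetric])
  have m1sq0: "m1\<^sup>2 \<ge> 0" by simp
  have goal: "\<bar>ln (1 + A) - m1 - (m2 - m1\<^sup>2) / 2\<bar> \<le> 100 * M ^ 3"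
  proof (cases "M \<le> 1 / 4")
    case True
    have "\<bar>\<Sum>\<sigma>\<in>S. w \<sigma> * (exp (u \<sigma>) - 1 - u \<sigma> - (u \<sigma>)\<^sup>2 / 2)\<bar> \<le> M ^ 3"
    proof (rule weighted_mean_bounded[OF w])
      fix \<sigma> assume "\<sigma> \<in> S"
      then have "\<bar>u \<sigma>\<bar> \<le> M" by (rule u)
      then have "\<bar>exp (u \<sigma>) - 1 - u \<sigma> - (u \<sigma>)\<^sup>2 / 2\<bar> \<le> \<bar>u \<sigma>\<bar> ^ 3"
        using True by (intro abs_exp_cubic_bound) auto
      also have "\<dots> \<le> M ^ 3" using \<open>\<bar>u \<sigma>\<bar> \<le> M\<close> by (intro power_mono) auto
      finally show "\<bar>exp (u \<sigma>) - 1 - u \<sigma> - (u \<sigma>)\<^sup>2 / 2\<bar> \<le> M ^ 3" .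
    qed
    also have "(\<Sum>\<sigma>\<in>S. w \<sigma> * (exp (u \<sigma>) - 1 - u \<sigma> - (u \<sigma>)\<^sup>2 / 2)) = A - m1 - m2 / 2"
      using w(2) by (simp add: A_def m1_def m2_def algebra_simps sum_subtractf sum.distrib sum_divide_distrib)
    finally have A: "\<bar>A - m1 - m2 / 2\<bar> \<le> M ^ 3" .
    have M3: "M ^ 3 \<le> M\<^sup>2 / 4" "M\<^sup>2 \<le> M / 4"
      using mult_right_mono[OF True, of "M\<^sup>2"] mult_right_mono[OF True, of M] M
      by (auto simp: power3_eq_cube power2_eq_square)
    have Am1: "\<bar>A - m1\<bar> \<le> M\<^sup>2" using A m2 M3 by linarith
    \<comment> \<open>With M <= 1/4 this gives |A| <= 1/2, the range of the logarithm
      estimate.\<close>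
    have A2: "\<bar>A\<bar> \<le> 2 * M" using Am1 m1 M3 M by linarith
    have "\<bar>A\<^sup>2 - m1\<^sup>2\<bar> = \<bar>A - m1\<bar> * \<bar>A + m1\<bar>"
      by (simp add: abs_mult[symmetric] power2_eq_square algebra_simps)
    also have "\<dots> \<le> M\<^sup>2 * (3 * M)"
      using Am1 A2 m1 by (intro mult_mono) auto
    finally have sq: "\<bar>A\<^sup>2 - m1\<^sup>2\<bar> \<le> 3 * M ^ 3" by (simp add: power3_eq_cube power2_eq_square)
    have "\<bar>ln (1 + A) - A + A\<^sup>2 / 2\<bar> \<le> 2 * \<bar>A\<bar> ^ 3"
      using A2 True by (intro abs_ln_one_plus_cubic_bound) auto
    also have "\<dots> \<le> 2 * (2 * M) ^ 3" using A2 by (intro mult_left_mono power_mono) auto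
    finally have "\<bar>ln (1 + A) - A + A\<^sup>2 / 2\<bar> \<le> 16 * M ^ 3" by (simp add: power_mult_distrib)
    moreover have "0 \<le> M ^ 3" using M by simp
    ultimately show ?thesis using A sq by argo
  next
    \<comment> \<open>For M > 1/4 each term is bounded separately; M <= 16 M^3 and M^2 <= 4 M^3
      absorb the bound 2 M + M^2 into 36 M^3.\<close>
    case False
    have "\<bar>ln (1 + A)\<bar> \<le> M"
      using log_laplace_bounded[OF S w u] by (simp add: A_def)
    then have *: "\<bar>ln (1 + A) - m1 - (m2 - m1\<^sup>2) / 2\<bar> \<le> 2 * M + M\<^sup>2"
      using m1 m2 m1sq m1sq0 by argo
    have "M\<^sup>2 \<ge> 1 / 4 * M" using mult_right_mono[of "1/4" M M] False M
      by (simp add: power2_eq_square)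
    moreover have "M ^ 3 \<ge> 1 / 4 * M\<^sup>2" using mult_right_mono[of "1/4" M "M\<^sup>2"] False M
      by (simp add: power2_eq_square power3_eq_cube)
    ultimately show ?thesis using * by linarith
  qed
  show ?thesis using goal by (simp add: A_def m1_def m2_def)
qed

text \<open>For 0/1-valued exponents the cubic error is proportional to the mean and not merely to
  its range; this makes the final error proportional to the probability that a clause is
  violated.\<close>

lemma log_laplace_bernoulli:
  fixes b m :: real
  assumes b: "0 < b" "b \<le> 1 / 4" and m: "0 \<le> m" "m \<le> 1"
  shows "\<bar>ln (1 - (1 - exp (- b)) * m) + b * m - b\<^sup>2 * (m - m\<^sup>2) / 2\<bar> \<le> 4 * b ^ 3 * m"
proof -
  \<comment> \<open>For a 0/1 variable with mean m the Laplace transform at -b is exactly 1 - q m,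
    so only the two scalars b and m enter.\<close>
  define q where "q = 1 - exp (- b)"
  have "\<bar>exp (- b) - 1 - (- b) - (- b)\<^sup>2 / 2\<bar> \<le> \<bar>- b\<bar> ^ 3"
    using b by (intro abs_exp_cubic_bound) auto
  then have q: "\<bar>q - b + b\<^sup>2 / 2\<bar> \<le> b ^ 3" using b unfolding q_def by (simp add: abs_le_iff)
  have b3: "b ^ 3 \<le> b\<^sup>2 / 4"
    using mult_right_mono[OF b(2), of "b\<^sup>2"] by (auto simp: power3_eq_cube power2_eq_square)
  have q0: "0 \<le> q" using b by (simp add: q_def)
  have qb: "q \<le> b" using exp_ge_add_one_self[of "- b"] by (simp add: q_def)
  have qb2: "\<bar>q - b\<bar> \<le> b\<^sup>2"
    using q b3 zero_le_power2[of b] by argo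
  have "\<bar>q\<^sup>2 - b\<^sup>2\<bar> = \<bar>q - b\<bar> * \<bar>q + b\<bar>"
    by (simp add: abs_mult[symmetric] power2_eq_square algebra_simps)
  also have "\<dots> \<le> b\<^sup>2 * (2 * b)" using qb2 qb q0 b by (intro mult_mono) auto
  finally have qsq: "\<bar>q\<^sup>2 - b\<^sup>2\<bar> \<le> 2 * b ^ 3" by (simp add: power3_eq_cube power2_eq_square)
  have qm: "0 \<le> q * m" "q * m \<le> b * m" using q0 qb m by (auto intro: mult_right_mono)
  have bm: "b * m \<le> 1 / 4" using b m mult_mono[of b "1/4" m 1] by auto
  \<comment> \<open>On [0, 1] the higher powers of m are at most m; these bounds keep the error
    linear in m.\<close>
  have m2: "m\<^sup>2 \<le> m" "m ^ 3 \<le> m"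
    using power_decreasing[of 1 2 m] power_decreasing[of 1 3 m] m by auto
  have "\<bar>ln (1 + (- (q * m))) - (- (q * m)) + (- (q * m))\<^sup>2 / 2\<bar> \<le> 2 * \<bar>- (q * m)\<bar> ^ 3"
    using qm bm by (intro abs_ln_one_plus_cubic_bound) auto
  also have "\<dots> \<le> 2 * (b * m) ^ 3" using qm by (intro mult_left_mono power_mono) auto
  also have "\<dots> = 2 * (b ^ 3 * m ^ 3)" by (simp add: power_mult_distrib)
  also have "\<dots> \<le> 2 * (b ^ 3 * m)" using m2 b by (intro mult_left_mono) auto
  finally have 1: "\<bar>ln (1 - q * m) + q * m + q\<^sup>2 * m\<^sup>2 / 2\<bar> \<le> 2 * (b ^ 3 * m)"
    by (simp add: power_mult_distrib)
  have "\<bar>(q - b + b\<^sup>2 / 2) * m\<bar> \<le> b ^ 3 * m"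
    using q m by (simp add: abs_mult mult_right_mono)
  then have 2: "\<bar>q * m - b * m + b\<^sup>2 * m / 2\<bar> \<le> b ^ 3 * m" by (simp add: algebra_simps)
  have "\<bar>(q\<^sup>2 - b\<^sup>2) * m\<^sup>2\<bar> \<le> 2 * b ^ 3 * m\<^sup>2"
    using qsq by (simp add: abs_mult mult_right_mono)
  also have "\<dots> \<le> 2 * b ^ 3 * m" using m2 b by (intro mult_left_mono) auto
  finally have 3: "\<bar>q\<^sup>2 * m\<^sup>2 - b\<^sup>2 * m\<^sup>2\<bar> \<le> 2 * (b ^ 3 * m)" by (simp add: algebra_simps)
  have "b\<^sup>2 * (m - m\<^sup>2) = b\<^sup>2 * m - b\<^sup>2 * m\<^sup>2" by (simp add: algebra_simps)
  then have "\<bar>ln (1 - q * m) + b * m - b\<^sup>2 * (m - m\<^sup>2) / 2\<bar> \<le> 4 * (b ^ 3 * m)"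
    using 1 2 3 by (simp only:) argo
  then show ?thesis by (simp add: q_def mult.assoc)
qed

section \<open>Log-sum-exp and its increments\<close>

definition lse :: "'s set \<Rightarrow> real \<Rightarrow> ('s \<Rightarrow> real) \<Rightarrow> real" where
  "lse S \<beta> x = ln (\<Sum>\<sigma>\<in>S. exp (\<beta> * x \<sigma>)) / \<beta>"

definition gibbs :: "'s set \<Rightarrow> real \<Rightarrow> ('s \<Rightarrow> real) \<Rightarrow> 's \<Rightarrow> real" where
  "gibbs S \<beta> x \<sigma> = exp (\<beta> * x \<sigma>) / (\<Sum>\<tau>\<in>S. exp (\<beta> * x \<tau>))"

lemma gibbs_nonneg: "0 \<le> gibbs S \<beta> x \<sigma>"
  by (simp add: gibbs_def sum_nonneg)

lemma sum_gibbs: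
  assumes "finite S" "S \<noteq> {}"
  shows "(\<Sum>\<sigma>\<in>S. gibbs S \<beta> x \<sigma>) = 1"
proof -
  have "0 < (\<Sum>\<tau>\<in>S. exp (\<beta> * x \<tau>))" using assms by (intro sum_pos) auto
  then show ?thesis by (simp add: gibbs_def sum_divide_distrib[symmetric])
qed

text \<open>The partition function of x + y divided by that of x is the Gibbs mean of exp (\<beta>
  y). The increment of \<open>lse\<close> is thus a cumulant generating function, to which the
  preceding expansions apply.\<close>

lemma lse_add:
  assumes "finite S" "S \<noteq> {}"
  shows "lse S \<beta> (\<lambda>\<sigma>. x \<sigma> + y \<sigma>) = lse S \<beta> x + ln (\<Sum>\<sigma>\<in>S. gibbs S \<beta> x \<sigma> * exp (\<beta> * y \<sigma>)) / \<beta>"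
proof -
  define Z where "Z = (\<Sum>\<tau>\<in>S. exp (\<beta> * x \<tau>))"
  have Z: "Z > 0" using assms unfolding Z_def by (intro sum_pos) auto
  have pos: "(\<Sum>\<sigma>\<in>S. exp (\<beta> * (x \<sigma> + y \<sigma>))) > 0" using assms by (intro sum_pos) auto
  have "(\<Sum>\<sigma>\<in>S. gibbs S \<beta> x \<sigma> * exp (\<beta> * y \<sigma>)) = (\<Sum>\<sigma>\<in>S. exp (\<beta> * (x \<sigma> + y \<sigma>))) / Z"
    by (simp add: gibbs_def Z_def sum_divide_distrib exp_add[symmetric] algebra_simps)
  then have "ln (\<Sum>\<sigma>\<in>S. gibbs S \<beta> x \<sigma> * exp (\<beta> * y \<sigma>)) = ln (\<Sum>\<sigma>\<in>S. exp (\<beta> * (x \<sigma> + y \<sigma>))) - ln Z"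
    using Z pos by (simp add: ln_div)
  then show ?thesis by (simp add: lse_def Z_def diff_divide_distrib)
qed

lemma lse_add_lipschitz:
  assumes S: "finite S" "S \<noteq> {}" and \<beta>: "\<beta> > 0" and y: "\<And>\<sigma>. \<sigma> \<in> S \<Longrightarrow> \<bar>y \<sigma>\<bar> \<le> M"
  shows "\<bar>lse S \<beta> (\<lambda>\<sigma>. x \<sigma> + y \<sigma>) - lse S \<beta> x\<bar> \<le> M"
proof -
  have "\<bar>ln (\<Sum>\<sigma>\<in>S. gibbs S \<beta> x \<sigma> * exp (\<beta> * y \<sigma>))\<bar> \<le> \<beta> * M"
    using y \<beta> by (intro log_laplace_bounded S gibbs_nonneg sum_gibbs) (auto simp: abs_mult)
  then show ?thesis using \<beta> by (simp add: lse_add[OF S] abs_divide field_simps)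
qed

text \<open>The cumulant expansion is applied to \<beta> y and divided by \<beta>, which turns the
  cubic error \<beta>^3 M^3 into \<beta>^2 M^3.\<close>

lemma lse_add_second_order:
  assumes S: "finite S" "S \<noteq> {}" and \<beta>: "\<beta> > 0" and y: "\<And>\<sigma>. \<sigma> \<in> S \<Longrightarrow> \<bar>y \<sigma>\<bar> \<le> M"
    and M: "0 \<le> M"
  shows "\<bar>lse S \<beta> (\<lambda>\<sigma>. x \<sigma> + y \<sigma>) - lse S \<beta> x - (\<Sum>\<sigma>\<in>S. gibbs S \<beta> x \<sigma> * y \<sigma>)
      - \<beta> / 2 * ((\<Sum>\<sigma>\<in>S. gibbs S \<beta> x \<sigma> * (y \<sigma>)\<^sup>2) - (\<Sum>\<sigma>\<in>S. gibbs S \<beta> x \<sigma> * y \<sigma>)\<^sup>2)\<bar>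
    \<le> 100 * \<beta>\<^sup>2 * M ^ 3" (is "\<bar>?D\<bar> \<le> _")
proof -
  have "\<bar>ln (\<Sum>\<sigma>\<in>S. gibbs S \<beta> x \<sigma> * exp (\<beta> * y \<sigma>)) - (\<Sum>\<sigma>\<in>S. gibbs S \<beta> x \<sigma> * (\<beta> * y \<sigma>))
    - ((\<Sum>\<sigma>\<in>S. gibbs S \<beta> x \<sigma> * (\<beta> * y \<sigma>)\<^sup>2) - (\<Sum>\<sigma>\<in>S. gibbs S \<beta> x \<sigma> * (\<beta> * y \<sigma>))\<^sup>2) / 2\<bar>
    \<le> 100 * (\<beta> * M) ^ 3" (is "\<bar>?E\<bar> \<le> _")
    using y \<beta> M by (intro log_laplace_second_order S gibbs_nonneg sum_gibbs) (auto simp: abs_mult)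
  moreover have "?E = \<beta> * ?D"
  proof -
    have 1: "(\<Sum>\<sigma>\<in>S. gibbs S \<beta> x \<sigma> * (\<beta> * y \<sigma>)) = \<beta> * (\<Sum>\<sigma>\<in>S. gibbs S \<beta> x \<sigma> * y \<sigma>)"
      by (simp add: sum_distrib_left mult_ac)
    have 2: "(\<Sum>\<sigma>\<in>S. gibbs S \<beta> x \<sigma> * (\<beta> * y \<sigma>)\<^sup>2) = \<beta>\<^sup>2 * (\<Sum>\<sigma>\<in>S. gibbs S \<beta> x \<sigma> * (y \<sigma>)\<^sup>2)"
      by (simp add: sum_distrib_left mult_ac power_mult_distrib)
    show ?thesis using \<beta> unfolding 1 2 lse_add[OF S]
      by (simp add: field_simps power2_eq_square)
  qed
  ultimately have "\<beta> * \<bar>?D\<bar> \<le> \<beta> * (100 * \<beta>\<^sup>2 * M ^ 3)"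
    using \<beta> by (simp add: abs_mult power_mult_distrib power3_eq_cube power2_eq_square mult_ac)
  then show ?thesis by (rule mult_left_le_imp_le) (use \<beta> in simp)
qed

text \<open>Under the Gibbs measure y is a Bernoulli variable, whose second moment is its mean;
  hence the variance m - m^2. After division by \<beta> the error is of order \<beta>^2 m, the term
  eventually balanced against the smoothing cost. The vector y is subtracted since a violated clause
  lowers the Hamiltonian.\<close>

lemma lse_diff_bernoulli:
  fixes x y :: "'s \<Rightarrow> real"
  assumes S: "finite S" "S \<noteq> {}" and \<beta>: "0 < \<beta>" "\<beta> \<le> 1 / 4"
    and y: "\<And>\<sigma>. \<sigma> \<in> S \<Longrightarrow> y \<sigma> = 0 \<or> y \<sigma> = 1"
  defines "m \<equiv> \<Sum>\<sigma>\<in>S. gibbs S \<beta> x \<sigma> * y \<sigma>"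
  shows "\<bar>lse S \<beta> (\<lambda>\<sigma>. x \<sigma> - y \<sigma>) - lse S \<beta> x + m - \<beta> / 2 * (m - m\<^sup>2)\<bar> \<le> 4 * \<beta>\<^sup>2 * m"
    (is "\<bar>?D\<bar> \<le> _")
proof -
  have m: "0 \<le> m" unfolding m_def using y
    by (intro sum_nonneg mult_nonneg_nonneg gibbs_nonneg) force
  have "\<bar>m\<bar> \<le> 1" unfolding m_def
    using y by (intro weighted_mean_bounded gibbs_nonneg sum_gibbs S) force
  then have m1: "m \<le> 1" by simp
  have "gibbs S \<beta> x \<sigma> * exp (\<beta> * (- y \<sigma>)) = gibbs S \<beta> x \<sigma> - (1 - exp (- \<beta>)) * (gibbs S \<beta> x \<sigma> * y \<sigma>)"
    if "\<sigma> \<in> S" for \<sigma>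
    using y[OF that] by (auto simp: algebra_simps)
  then have "(\<Sum>\<sigma>\<in>S. gibbs S \<beta> x \<sigma> * exp (\<beta> * (- y \<sigma>))) = 1 - (1 - exp (- \<beta>)) * m"
    by (simp add: sum_subtractf sum_gibbs[OF S] sum_distrib_left m_def cong: sum.cong)
  then have "lse S \<beta> (\<lambda>\<sigma>. x \<sigma> - y \<sigma>) = lse S \<beta> x + ln (1 - (1 - exp (- \<beta>)) * m) / \<beta>"
    using lse_add[OF S, of \<beta> x "\<lambda>\<sigma>. - y \<sigma>"] by simp
  then have "ln (1 - (1 - exp (- \<beta>)) * m) + \<beta> * m - \<beta>\<^sup>2 * (m - m\<^sup>2) / 2 = \<beta> * ?D"
    using \<beta> by (simp add: field_simps power2_eq_square)
  then have "\<beta> * \<bar>?D\<bar> \<le> \<beta> * (4 * \<beta>\<^sup>2 * m)"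
    using log_laplace_bernoulli[OF \<beta> m m1] \<beta>
    by (simp add: abs_mult power3_eq_cube power2_eq_square mult_ac)
  then show ?thesis by (rule mult_left_le_imp_le) (use \<beta> in simp)
qed

lemma lse_Max_bounds:
  assumes S: "finite S" "S \<noteq> {}" and \<beta>: "\<beta> > 0"
  shows "Max (x ` S) \<le> lse S \<beta> x" "lse S \<beta> x \<le> Max (x ` S) + ln (card S) / \<beta>"
proof -
  define Mx where "Mx = Max (x ` S)"
  obtain \<sigma>0 where \<sigma>0: "\<sigma>0 \<in> S" "Mx = x \<sigma>0"
    using Max_in[of "x ` S"] S unfolding Mx_def by blast
  have pos: "(\<Sum>\<sigma>\<in>S. exp (\<beta> * x \<sigma>)) > 0" using S by (intro sum_pos) auto
  have "exp (\<beta> * Mx) \<le> (\<Sum>\<sigma>\<in>S. exp (\<beta> * x \<sigma>))"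
    using \<sigma>0 S by (auto intro: member_le_sum)
  then have "\<beta> * Mx \<le> ln (\<Sum>\<sigma>\<in>S. exp (\<beta> * x \<sigma>))"
    using pos by (simp add: ln_ge_iff)
  then show "Max (x ` S) \<le> lse S \<beta> x"
    using \<beta> by (simp add: lse_def Mx_def field_simps)
  have "(\<Sum>\<sigma>\<in>S. exp (\<beta> * x \<sigma>)) \<le> (\<Sum>\<sigma>\<in>S. exp (\<beta> * Mx))"
    using S \<beta> by (intro sum_mono) (auto simp: Mx_def)
  then have "ln (\<Sum>\<sigma>\<in>S. exp (\<beta> * x \<sigma>)) \<le> ln (card S * exp (\<beta> * Mx))"
    using pos by (subst ln_le_cancel_iff) auto
  also have "\<dots> = ln (card S) + \<beta> * Mx"
    using S by (subst ln_mult) (auto simp: card_gt_0_iff)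
  finally show "lse S \<beta> x \<le> Max (x ` S) + ln (card S) / \<beta>"
    using \<beta> by (simp add: lse_def Mx_def field_simps)
qed

section \<open>Gaussian vectors\<close>

lemma distr_pair_snd:
  assumes "prob_space M" "prob_space N"
  shows "distr (M \<Otimes>\<^sub>M N) N snd = N"
proof -
  interpret M: prob_space M by fact
  interpret N: prob_space N by fact
  interpret P: pair_sigma_finite M N ..
  interpret Q: pair_sigma_finite N M ..
  have "distr (M \<Otimes>\<^sub>M N) N snd = distr (distr (N \<Otimes>\<^sub>M M) (M \<Otimes>\<^sub>M N) (\<lambda>(x, y). (y, x))) N snd"
    by (simp only: P.distr_pair_swap[symmetric])
  also have "\<dots> = distr (N \<Otimes>\<^sub>M M) N fst"
    by (subst distr_distr) (auto simp: comp_def case_prod_unfold)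
  also have "\<dots> = N" by (rule M.distr_pair_fst)
  finally show ?thesis .
qed

lemma prob_space_std_normal: "prob_space std_normal_distribution"
  by (rule prob_space_normal_density) simp

lemma distributed_scaled_std_normal:
  assumes "prob_space M" and X: "X \<in> borel_measurable M"
    and D: "distr M borel X = std_normal_distribution" and s: "0 < s"
  shows "distributed M lborel (\<lambda>x. sqrt s * X x) (normal_density 0 (sqrt s))"
proof -
  interpret prob_space M by fact
  have "distributed M lborel X std_normal_density"
    unfolding distributed_def using X D
    by (auto simp: distr_cong[OF refl sets_lborel refl])
  then show ?thesis
    using s by (subst normal_standard_normal_convert) auto
qed

text \<open>Independent centred normals add their variances. The statement is about nonnegative
  integrals, so the induction on coordinates can use Tonelli without integrability.\<close>

lemma nn_integral_std_normal_add:
  fixes f :: "real \<Rightarrow> ennreal"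
  assumes f[measurable]: "f \<in> borel_measurable borel" and s: "0 < s" and t: "0 < t"
  shows "(\<integral>\<^sup>+z. \<integral>\<^sup>+z'. f (sqrt s * z + sqrt t * z') \<partial>std_normal_distribution \<partial>std_normal_distribution)
    = (\<integral>\<^sup>+z. f (sqrt (s + t) * z) \<partial>std_normal_distribution)"
proof -
  let ?N = "std_normal_distribution"
  interpret N: prob_space ?N by (rule prob_space_std_normal)
  interpret P: pair_prob_space ?N ?N by standard
  let ?P = "?N \<Otimes>\<^sub>M ?N"
  have fst: "distr ?P borel fst = ?N"
    using N.distr_pair_fst[of ?N] by (simp cong: distr_cong)
  have snd: "distr ?P borel snd = ?N"
    using distr_pair_snd[OF prob_space_std_normal prob_space_std_normal] by (simp cong: distr_cong)
  have [measurable]: "fst \<in> borel_measurable ?P" "snd \<in> borel_measurable ?P" by measurable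
  have "distr ?P (borel \<Otimes>\<^sub>M borel) (\<lambda>x. (fst x, snd x)) = ?P"
    by (simp only: prod.collapse, rule distr_id2) (intro sets_pair_measure_cong, simp_all)
  then have "P.indep_var borel fst borel snd"
    unfolding P.indep_var_distribution_eq fst snd by simp
  then have "P.indep_var borel ((\<lambda>x. sqrt s * x) \<circ> fst) borel ((\<lambda>x. sqrt t * x) \<circ> snd)"
    by (rule P.indep_var_compose) auto
  then have ind: "P.indep_var borel (\<lambda>x. sqrt s * fst x) borel (\<lambda>x. sqrt t * snd x)"
    by (simp add: o_def)
  have "distributed ?P lborel (\<lambda>x. sqrt s * fst x + sqrt t * snd x)
      (normal_density (0 + 0) (sqrt ((sqrt s)\<^sup>2 + (sqrt t)\<^sup>2)))"
    using s t fst snd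
    by (intro P.add_indep_normal[OF ind] distributed_scaled_std_normal P.prob_space_axioms) auto
  then have 1: "distributed ?P lborel (\<lambda>x. sqrt s * fst x + sqrt t * snd x) (normal_density 0 (sqrt (s + t)))"
    using s t by simp
  have 2: "distributed ?N lborel (\<lambda>x. sqrt (s + t) * x) (normal_density 0 (sqrt (s + t)))"
    using s t by (intro distributed_scaled_std_normal prob_space_std_normal)
      (auto intro!: distr_id2)
  have "(\<integral>\<^sup>+z. \<integral>\<^sup>+z'. f (sqrt s * z + sqrt t * z') \<partial>?N \<partial>?N)
      = (\<integral>\<^sup>+x. f (sqrt s * fst x + sqrt t * snd x) \<partial>?P)"
    by (subst N.nn_integral_fst[symmetric]) auto
  also have "\<dots> = (\<integral>\<^sup>+x. normal_density 0 (sqrt (s + t)) x * f x \<partial>lborel)"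
    by (rule distributed_nn_integral[OF 1, symmetric]) auto
  also have "\<dots> = (\<integral>\<^sup>+z. f (sqrt (s + t) * z) \<partial>?N)"
    by (rule distributed_nn_integral[OF 2]) auto
  finally show ?thesis .
qed

abbreviation std_gaussian :: "'i set \<Rightarrow> ('i \<Rightarrow> real) measure" where
  "std_gaussian I \<equiv> \<Pi>\<^sub>M i\<in>I. std_normal_distribution"

lemma prob_space_std_gaussian: "prob_space (std_gaussian I)"
  by (intro prob_space_PiM prob_space_std_normal)

text \<open>Induction over coordinates: the new coordinate of both vectors is split off, the two
  scalar integrals are brought together, and the one-dimensional identity merges them. The induction
  hypothesis then treats the remaining coordinates, with the merged one as part of the
  integrand.\<close>

lemma nn_integral_std_gaussian_add:
  fixes f :: "('i \<Rightarrow> real) \<Rightarrow> ennreal"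
  assumes "finite I" and s: "0 < s" and t: "0 < t"
    and f: "f \<in> borel_measurable (\<Pi>\<^sub>M i\<in>I. borel)"
  shows "(\<integral>\<^sup>+g. \<integral>\<^sup>+g'. f (\<lambda>i\<in>I. sqrt s * g i + sqrt t * g' i) \<partial>std_gaussian I \<partial>std_gaussian I)
    = (\<integral>\<^sup>+g. f (\<lambda>i\<in>I. sqrt (s + t) * g i) \<partial>std_gaussian I)"
  using assms(1,4)
proof (induction I arbitrary: f rule: finite_induct)
  case empty
  show ?case by (simp add: PiM_empty nn_integral_count_space_finite)
next
  case (insert i I)
  let ?N = "std_normal_distribution" and ?G = "std_gaussian I" and ?G' = "std_gaussian (insert i I)"
  note [measurable] = \<open>f \<in> borel_measurable (\<Pi>\<^sub>M i\<in>insert i I. borel)\<close>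
  interpret N: prob_space ?N by (rule prob_space_std_normal)
  interpret G: prob_space ?G by (rule prob_space_std_gaussian)
  interpret G': prob_space ?G' by (rule prob_space_std_gaussian)
  interpret PS: product_sigma_finite "\<lambda>_::'i. ?N" by standard
  interpret NG: pair_sigma_finite ?N ?G by standard
  interpret GN: pair_sigma_finite ?G ?N by standard
  have upd[measurable]: "(\<lambda>(x, z). x(i := z)) \<in> (\<Pi>\<^sub>M i\<in>I. borel) \<Otimes>\<^sub>M borel \<rightarrow>\<^sub>M (\<Pi>\<^sub>M i\<in>insert i I. borel)"
    by measurable
  have res: "(\<lambda>j\<in>insert i I. c * (g(i := z)) j + d * (g'(i := z')) j)
      = (\<lambda>j\<in>I. c * g j + d * g' j)(i := c * z + d * z')" for c d z z' :: real and g g' :: "'i \<Rightarrow> real"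
    using insert.hyps by (auto simp: fun_eq_iff restrict_def)
  have res1: "(\<lambda>j\<in>insert i I. c * (g(i := z)) j)
      = (\<lambda>j\<in>I. c * g j)(i := c * z)" for c z :: real and g :: "'i \<Rightarrow> real"
    using insert.hyps by (auto simp: fun_eq_iff restrict_def)
  have "(\<integral>\<^sup>+g. \<integral>\<^sup>+g'. f (\<lambda>j\<in>insert i I. sqrt s * g j + sqrt t * g' j) \<partial>?G' \<partial>?G')
     = (\<integral>\<^sup>+g. \<integral>\<^sup>+z. \<integral>\<^sup>+g'. f (\<lambda>j\<in>insert i I. sqrt s * (g(i := z)) j + sqrt t * g' j) \<partial>?G' \<partial>?N \<partial>?G)"
    using insert.hyps by (subst PS.product_nn_integral_insert) simp_all
  also have "\<dots> = (\<integral>\<^sup>+g. \<integral>\<^sup>+z. \<integral>\<^sup>+g'. \<integral>\<^sup>+z'. f ((\<lambda>j\<in>I. sqrt s * g j + sqrt t * g' j)(i := sqrt s * z + sqrt t * z')) \<partial>?N \<partial>?G \<partial>?N \<partial>?G)"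
    using insert.hyps
    by (subst PS.product_nn_integral_insert) (simp_all add: res del: fun_upd_apply)
  \<comment> \<open>Tonelli moves the integral over z past the one over g', so that both integrals
    over coordinate i are innermost.\<close>
  also have "\<dots> = (\<integral>\<^sup>+g. \<integral>\<^sup>+g'. \<integral>\<^sup>+z. \<integral>\<^sup>+z'. f ((\<lambda>j\<in>I. sqrt s * g j + sqrt t * g' j)(i := sqrt s * z + sqrt t * z')) \<partial>?N \<partial>?N \<partial>?G \<partial>?G)"
    by (intro nn_integral_cong NG.Fubini'[symmetric]) measurable
  also have "\<dots> = (\<integral>\<^sup>+g. \<integral>\<^sup>+g'. \<integral>\<^sup>+z. f ((\<lambda>j\<in>I. sqrt s * g j + sqrt t * g' j)(i := sqrt (s + t) * z)) \<partial>?N \<partial>?G \<partial>?G)"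
  proof (rule nn_integral_cong, rule nn_integral_cong)
    fix g g' :: "'i \<Rightarrow> real"
    have [measurable]: "(\<lambda>z. f ((\<lambda>j\<in>I. sqrt s * g j + sqrt t * g' j)(i := z))) \<in> borel_measurable borel"
      by (rule measurable_compose[OF _ \<open>f \<in> _\<close>], rule measurable_fun_upd[where J=I])
         (auto simp: space_PiM intro!: measurable_const)
    show "(\<integral>\<^sup>+z. \<integral>\<^sup>+z'. f ((\<lambda>j\<in>I. sqrt s * g j + sqrt t * g' j)(i := sqrt s * z + sqrt t * z')) \<partial>?N \<partial>?N)
      = (\<integral>\<^sup>+z. f ((\<lambda>j\<in>I. sqrt s * g j + sqrt t * g' j)(i := sqrt (s + t) * z)) \<partial>?N)"
      by (rule nn_integral_std_normal_add[OF _ s t]) measurable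
  qed
  also have "\<dots> = (\<integral>\<^sup>+g. \<integral>\<^sup>+z. f ((\<lambda>j\<in>I. sqrt (s + t) * g j)(i := sqrt (s + t) * z)) \<partial>?N \<partial>?G)"
    by (rule insert.IH) measurable
  also have "\<dots> = (\<integral>\<^sup>+g. f (\<lambda>j\<in>insert i I. sqrt (s + t) * g j) \<partial>?G')"
    using insert.hyps
    by (subst PS.product_nn_integral_insert) (simp_all add: res1 del: fun_upd_apply)
  finally show ?case .
qed

text \<open>Indicators turn the identity of integrals into an equality of laws, which transfers
  integrability and integrals of signed functions as well.\<close>

lemma distr_std_gaussian_add:
  assumes "finite I" and s: "0 < s" and t: "0 < t"
  shows "distr (std_gaussian I \<Otimes>\<^sub>M std_gaussian I) (\<Pi>\<^sub>M i\<in>I. borel)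
      (\<lambda>(g, g'). \<lambda>i\<in>I. sqrt s * g i + sqrt t * g' i)
    = distr (std_gaussian I) (\<Pi>\<^sub>M i\<in>I. borel) (\<lambda>g. \<lambda>i\<in>I. sqrt (s + t) * g i)" (is "?L = ?R")
proof (rule measure_eqI)
  fix A assume "A \<in> sets ?L"
  then have [measurable]: "A \<in> sets (\<Pi>\<^sub>M i\<in>I. (borel :: real measure))" by simp
  let ?G = "std_gaussian I"
  interpret G: prob_space ?G by (rule prob_space_std_gaussian)
  have "emeasure ?L A = (\<integral>\<^sup>+x. indicator A x \<partial>?L)" by simp
  also have "\<dots> = (\<integral>\<^sup>+x. indicator A (\<lambda>i\<in>I. sqrt s * fst x i + sqrt t * snd x i) \<partial>(?G \<Otimes>\<^sub>M ?G))"
    by (subst nn_integral_distr) (auto simp: case_prod_unfold)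
  also have "\<dots> = (\<integral>\<^sup>+g. \<integral>\<^sup>+g'. indicator A (\<lambda>i\<in>I. sqrt s * g i + sqrt t * g' i) \<partial>?G \<partial>?G)"
    by (subst G.nn_integral_fst[symmetric]) auto
  also have "\<dots> = (\<integral>\<^sup>+g. indicator A (\<lambda>i\<in>I. sqrt (s + t) * g i) \<partial>?G)"
    by (rule nn_integral_std_gaussian_add[OF assms]) measurable
  also have "\<dots> = (\<integral>\<^sup>+x. indicator A x \<partial>?R)"
    by (subst nn_integral_distr) auto
  finally show "emeasure ?L A = emeasure ?R A" by simp
qed simp

section \<open>Moments of standard Gaussian coordinates\<close>

lemma has_bochner_integral_std_normal:
  assumes "f \<in> borel_measurable borel"
    and "has_bochner_integral lborel (\<lambda>x. std_normal_density x * f x) c"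
  shows "has_bochner_integral std_normal_distribution f c"
  using assms by (intro has_bochner_integral_density) auto

lemma
  assumes "i \<in> I"
  shows integrable_std_gaussian_abs_power: "integrable (std_gaussian I) (\<lambda>g. \<bar>g i\<bar> ^ k)"
    and integrable_std_gaussian_component: "integrable (std_gaussian I) (\<lambda>g. g i)"
    and integral_std_gaussian_component: "(\<integral>g. g i \<partial>std_gaussian I) = 0"
    and integral_std_gaussian_square: "(\<integral>g. (g i)\<^sup>2 \<partial>std_gaussian I) = 1"
proof -
  let ?N = "std_normal_distribution"
  have D: "distr (std_gaussian I) ?N (\<lambda>g. g i) = ?N"
    using assms by (intro distr_PiM_component prob_space_std_normal)
  have m[measurable]: "(\<lambda>g. g i) \<in> std_gaussian I \<rightarrow>\<^sub>M ?N" using assms by measurable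
  have int: "integrable (std_gaussian I) (\<lambda>g. f (g i))" if "integrable ?N f" for f :: "real \<Rightarrow> real"
    using that by (subst (asm) D[symmetric]) (rule integrable_distr[OF m])
  have val: "(\<integral>g. f (g i) \<partial>std_gaussian I) = integral\<^sup>L ?N f"
    if "f \<in> borel_measurable borel" for f :: "real \<Rightarrow> real"
    using that by (subst D[symmetric]) (simp add: integral_distr[OF m])
  show "integrable (std_gaussian I) (\<lambda>g. \<bar>g i\<bar> ^ k)"
    by (rule int) (subst integrable_density, auto intro: integrable_std_normal_moment_abs)
  show "integrable (std_gaussian I) (\<lambda>g. g i)"
    using integrable_std_normal_moment[of 1]
    by (intro int) (subst integrable_density, auto)
  have "has_bochner_integral ?N (\<lambda>x. x ^ (2 * 0 + 1)) 0"
    using std_normal_moment_odd[of 0] by (intro has_bochner_integral_std_normal) auto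
  from has_bochner_integral_integral_eq[OF this] show "(\<integral>g. g i \<partial>std_gaussian I) = 0"
    using val[of "\<lambda>x. x"] by simp
  have "has_bochner_integral ?N (\<lambda>x. x ^ (2 * 1)) (fact (2 * 1) / (2 ^ 1 * fact 1))"
    using std_normal_moment_even[of 1] by (intro has_bochner_integral_std_normal) auto
  from has_bochner_integral_integral_eq[OF this] show "(\<integral>g. (g i)\<^sup>2 \<partial>std_gaussian I) = 1"
    using val[of "\<lambda>x. x\<^sup>2"] by (simp add: fact_numeral)
qed

lemma
  assumes I: "finite I" "i \<in> I" "j \<in> I"
  shows integrable_std_gaussian_mult: "integrable (std_gaussian I) (\<lambda>g. g i * g j)"
    and integral_std_gaussian_mult: "(\<integral>g. g i * g j \<partial>std_gaussian I) = of_bool (i = j)"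
proof -
  have sq: "integrable (std_gaussian I) (\<lambda>g. (g k)\<^sup>2)" if "k \<in> I" for k
    using integrable_std_gaussian_abs_power[OF that, of 2] by simp
  have [measurable]: "(\<lambda>g. g i) \<in> borel_measurable (std_gaussian I)" "(\<lambda>g. g j) \<in> borel_measurable (std_gaussian I)"
    using I by measurable
  show int: "integrable (std_gaussian I) (\<lambda>g. g i * g j)"
  proof (rule Bochner_Integration.integrable_bound)
    show "integrable (std_gaussian I) (\<lambda>g. (g i)\<^sup>2 + (g j)\<^sup>2)"
      using sq I by auto
    show "AE g in std_gaussian I. norm (g i * g j) \<le> norm ((g i)\<^sup>2 + (g j)\<^sup>2)"
    proof (intro AE_I2)
      fix g :: "'a \<Rightarrow> real"
      have "2 * \<bar>g i\<bar> * \<bar>g j\<bar> \<le> (g i)\<^sup>2 + (g j)\<^sup>2"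
        using sum_squares_bound[of "\<bar>g i\<bar>" "\<bar>g j\<bar>"] by simp
      moreover have "0 \<le> \<bar>g i\<bar> * \<bar>g j\<bar>" by simp
      ultimately have "\<bar>g i\<bar> * \<bar>g j\<bar> \<le> (g i)\<^sup>2 + (g j)\<^sup>2" by argo
      then show "norm (g i * g j) \<le> norm ((g i)\<^sup>2 + (g j)\<^sup>2)"
        by (simp add: abs_mult)
    qed
  qed measurable
  show "(\<integral>g. g i * g j \<partial>std_gaussian I) = of_bool (i = j)"
  proof (cases "i = j")
    case True
    then show ?thesis using integral_std_gaussian_square[OF I(2)] by (simp add: power2_eq_square)
  next
    case False
    interpret N: prob_space "std_normal_distribution" by (rule prob_space_std_normal)
    interpret PS: product_sigma_finite "\<lambda>_::'a. std_normal_distribution" by standard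
    have intN: "integrable std_normal_distribution (\<lambda>x. x)"
      using integrable_std_normal_moment[of 1] by (subst integrable_density) auto
    have 0: "(\<integral>x. x \<partial>std_normal_distribution) = 0"
      using has_bochner_integral_std_normal[of "\<lambda>x. x ^ (2 * 0 + 1)" 0] std_normal_moment_odd[of 0]
      by (auto dest: has_bochner_integral_integral_eq)
    \<comment> \<open>Padding with factors 1 writes the product of two coordinates as a product over
      all of I, to which the product rule for integrals applies; the factor at i integrates to
      0.\<close>
    have prod: "(\<Prod>k\<in>I. (if k = i \<or> k = j then g k else 1)) = g i * g j" for g :: "'a \<Rightarrow> real"
    proof -
      have "(\<Prod>k\<in>I. (if k = i \<or> k = j then g k else 1)) = (\<Prod>k\<in>{i, j}. g k)"
        using I by (intro prod.mono_neutral_cong_right) auto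
      then show ?thesis using False by simp
    qed
    have "(\<integral>g. g i * g j \<partial>std_gaussian I)
      = (\<integral>g. (\<Prod>k\<in>I. (if k = i \<or> k = j then g k else 1)) \<partial>std_gaussian I)"
      by (simp only: prod)
    also have "\<dots> = (\<Prod>k\<in>I. \<integral>x. (if k = i \<or> k = j then x else 1) \<partial>std_normal_distribution)"
    proof (intro PS.product_integral_prod)
      show "integrable std_normal_distribution (\<lambda>x. if k = i \<or> k = j then x else 1)" for k
        using intN by (cases "k = i \<or> k = j") auto
    qed fact
    also have "\<dots> = 0"
      using I 0 by (intro prod_zero bexI[of _ i]) simp_all
    finally show ?thesis using False by simp
  qed
qed

section \<open>Gaussian shifts of the smooth maximum\<close>

lemma power3_sum_le:
  fixes a :: "'i \<Rightarrow> real"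
  assumes I: "finite I" and a: "\<And>i. i \<in> I \<Longrightarrow> 0 \<le> a i"
  shows "(\<Sum>i\<in>I. a i) ^ 3 \<le> real (card I) ^ 3 * (\<Sum>i\<in>I. a i ^ 3)"
proof (cases "I = {}")
  case False
  \<comment> \<open>Every summand is at most the largest, whose cube is at most the sum of the
    cubes. The constant is crude, but only integrability of a third moment is drawn from it.\<close>
  obtain k where k: "k \<in> I" "a k = Max (a ` I)"
    using Max_in[of "a ` I"] I False by (metis (no_types) finite_imageI image_iff image_is_empty)
  have "(\<Sum>i\<in>I. a i) \<le> real (card I) * a k"
    using I k by (intro sum_bounded_above) auto
  then have "(\<Sum>i\<in>I. a i) ^ 3 \<le> (real (card I) * a k) ^ 3"
    using a by (intro power_mono sum_nonneg) auto
  also have "\<dots> = real (card I) ^ 3 * a k ^ 3" by (simp add: power_mult_distrib)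
  also have "\<dots> \<le> real (card I) ^ 3 * (\<Sum>i\<in>I. a i ^ 3)"
    using I k a by (intro mult_left_mono member_le_sum) auto
  finally show ?thesis .
qed simp

text \<open>Under \<open>std_gaussian I\<close> this is a centred Gaussian process on S whose
  covariance at \<sigma>, \<tau> is the sum over i of v i \<sigma> * v i \<tau>. All randomness sits
  in the coordinates g, so a product measure over I suffices.\<close>

definition gauss_vec :: "'i set \<Rightarrow> ('i \<Rightarrow> 's \<Rightarrow> real) \<Rightarrow> ('i \<Rightarrow> real) \<Rightarrow> 's \<Rightarrow> real" where
  "gauss_vec I v g \<sigma> = (\<Sum>i\<in>I. g i * v i \<sigma>)"

locale gaussian_lse =
  fixes S :: "'s set" and \<beta> :: real and I :: "'i set" and v :: "'i \<Rightarrow> 's \<Rightarrow> real"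
  assumes finite_S: "finite S" and S_ne: "S \<noteq> {}" and \<beta>_pos: "0 < \<beta>" and finite_I: "finite I"
begin

text \<open>A random envelope: it dominates the process at all \<sigma> simultaneously and, being a
  combination of the |g i|, has a finite third moment.\<close>

definition gauss_size :: "('i \<Rightarrow> real) \<Rightarrow> real" where
  "gauss_size g = (\<Sum>i\<in>I. \<bar>g i\<bar> * (\<Sum>\<sigma>\<in>S. \<bar>v i \<sigma>\<bar>))"

text \<open>The heat semigroup of the process applied to the smooth maximum: s is time and a is the
  starting point, kept free so that steps can be composed.\<close>

definition gauss_mean :: "('s \<Rightarrow> real) \<Rightarrow> real \<Rightarrow> real" where
  "gauss_mean a s = (\<integral>g. lse S \<beta> (\<lambda>\<sigma>. a \<sigma> + sqrt s * gauss_vec I v g \<sigma>) \<partial>std_gaussian I)"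

lemma gauss_size_nonneg: "0 \<le> gauss_size g"
  unfolding gauss_size_def by (intro sum_nonneg mult_nonneg_nonneg) auto

lemma abs_gauss_vec_le:
  assumes "\<sigma> \<in> S"
  shows "\<bar>gauss_vec I v g \<sigma>\<bar> \<le> gauss_size g"
proof -
  have "\<bar>gauss_vec I v g \<sigma>\<bar> \<le> (\<Sum>i\<in>I. \<bar>g i * v i \<sigma>\<bar>)"
    unfolding gauss_vec_def by (rule sum_abs)
  also have "\<dots> \<le> gauss_size g"
    unfolding gauss_size_def abs_mult using assms finite_S
    by (intro sum_mono mult_left_mono member_le_sum) auto
  finally show ?thesis .
qed

lemma measurable_gauss_vec[measurable]: "(\<lambda>g. gauss_vec I v g \<sigma>) \<in> borel_measurable (std_gaussian I)"
  unfolding gauss_vec_def by measurable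

lemma measurable_gauss_size[measurable]: "gauss_size \<in> borel_measurable (std_gaussian I)"
  unfolding gauss_size_def by measurable

lemma measurable_lse_gauss[measurable]:
  "(\<lambda>g. lse S \<beta> (\<lambda>\<sigma>. a \<sigma> + c * gauss_vec I v g \<sigma>)) \<in> borel_measurable (std_gaussian I)"
  unfolding lse_def by measurable

lemma integrable_gauss_size: "integrable (std_gaussian I) gauss_size"
proof -
  have "integrable (std_gaussian I) (\<lambda>g. \<bar>g i\<bar>)" if "i \<in> I" for i
    using integrable_std_gaussian_abs_power[OF that, of 1] by simp
  then show ?thesis unfolding gauss_size_def by auto
qed

lemma integrable_gauss_size_cube: "integrable (std_gaussian I) (\<lambda>g. gauss_size g ^ 3)"
proof (rule Bochner_Integration.integrable_bound)
  show "integrable (std_gaussian I)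
      (\<lambda>g. real (card I) ^ 3 * (\<Sum>i\<in>I. \<bar>g i\<bar> ^ 3 * (\<Sum>\<sigma>\<in>S. \<bar>v i \<sigma>\<bar>) ^ 3))"
    by (intro integrable_mult_right Bochner_Integration.integrable_sum integrable_mult_left
        integrable_std_gaussian_abs_power)
  show "AE g in std_gaussian I. norm (gauss_size g ^ 3)
      \<le> norm (real (card I) ^ 3 * (\<Sum>i\<in>I. \<bar>g i\<bar> ^ 3 * (\<Sum>\<sigma>\<in>S. \<bar>v i \<sigma>\<bar>) ^ 3))"
  proof (intro AE_I2)
    fix g :: "'i \<Rightarrow> real"
    have "gauss_size g ^ 3 \<le> real (card I) ^ 3 * (\<Sum>i\<in>I. (\<bar>g i\<bar> * (\<Sum>\<sigma>\<in>S. \<bar>v i \<sigma>\<bar>)) ^ 3)"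
      unfolding gauss_size_def
      by (intro power3_sum_le finite_I mult_nonneg_nonneg sum_nonneg) auto
    then show "norm (gauss_size g ^ 3)
      \<le> norm (real (card I) ^ 3 * (\<Sum>i\<in>I. \<bar>g i\<bar> ^ 3 * (\<Sum>\<sigma>\<in>S. \<bar>v i \<sigma>\<bar>) ^ 3))"
      using gauss_size_nonneg[of g] by (simp add: power_mult_distrib)
  qed
qed measurable

lemma lse_gauss_diff:
  "\<bar>lse S \<beta> (\<lambda>\<sigma>. a \<sigma> + c * gauss_vec I v g \<sigma>) - lse S \<beta> a\<bar> \<le> \<bar>c\<bar> * gauss_size g"
  by (intro lse_add_lipschitz finite_S S_ne \<beta>_pos)
     (auto simp: abs_mult intro!: mult_left_mono abs_gauss_vec_le)

lemma integrable_lse_gauss: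
  "integrable (std_gaussian I) (\<lambda>g. lse S \<beta> (\<lambda>\<sigma>. a \<sigma> + c * gauss_vec I v g \<sigma>))"
proof -
  interpret G: prob_space "std_gaussian I" by (rule prob_space_std_gaussian)
  show ?thesis
  proof (rule Bochner_Integration.integrable_bound)
    show "integrable (std_gaussian I) (\<lambda>g. \<bar>lse S \<beta> a\<bar> + \<bar>c\<bar> * gauss_size g)"
      using integrable_gauss_size by auto
    show "AE g in std_gaussian I. norm (lse S \<beta> (\<lambda>\<sigma>. a \<sigma> + c * gauss_vec I v g \<sigma>))
        \<le> norm (\<bar>lse S \<beta> a\<bar> + \<bar>c\<bar> * gauss_size g)"
    proof (intro AE_I2)
      fix g :: "'i \<Rightarrow> real"
      show "norm (lse S \<beta> (\<lambda>\<sigma>. a \<sigma> + c * gauss_vec I v g \<sigma>)) \<le> norm (\<bar>lse S \<beta> a\<bar> + \<bar>c\<bar> * gauss_size g)"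
        using lse_gauss_diff[of a c g] mult_nonneg_nonneg[of "\<bar>c\<bar>" "gauss_size g"] gauss_size_nonneg[of g]
        unfolding real_norm_def by linarith
    qed
  qed measurable
qed

text \<open>Semigroup property: independent increments of variance s and h add up to one of variance
  s + h. Value and integrability both come from carrying the integrand over by the equality of laws
  and integrating out one factor.\<close>

lemma
  assumes s: "0 \<le> s" and h: "0 < h"
  shows gauss_mean_add: "gauss_mean a (s + h)
      = (\<integral>g. gauss_mean (\<lambda>\<sigma>. a \<sigma> + sqrt s * gauss_vec I v g \<sigma>) h \<partial>std_gaussian I)" (is ?eq)
    and integrable_gauss_mean: "integrable (std_gaussian I)
      (\<lambda>g. gauss_mean (\<lambda>\<sigma>. a \<sigma> + sqrt s * gauss_vec I v g \<sigma>) h)" (is ?int)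
proof -
  let ?G = "std_gaussian I" and ?B = "\<Pi>\<^sub>M i\<in>I. (borel :: real measure)"
  interpret G: prob_space ?G by (rule prob_space_std_gaussian)
  interpret GG: pair_sigma_finite ?G ?G by standard
  have "?eq \<and> ?int"
  proof (cases "s = 0")
    \<comment> \<open>The addition of laws is stated for positive variances; at s = 0 the outer
      integrand is constant in g.\<close>
    case True
    then show ?thesis by (simp add: G.prob_space)
  next
    case False
    with s have s: "0 < s" by simp
    define \<Phi> where "\<Phi> = (\<lambda>x. lse S \<beta> (\<lambda>\<sigma>. a \<sigma> + gauss_vec I v x \<sigma>))"
    have \<Phi>[measurable]: "\<Phi> \<in> borel_measurable ?B"
      unfolding \<Phi>_def lse_def gauss_vec_def by measurable
    have 1: "\<Phi> (\<lambda>i\<in>I. sqrt (s + h) * g i) = lse S \<beta> (\<lambda>\<sigma>. a \<sigma> + sqrt (s + h) * gauss_vec I v g \<sigma>)" for g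
      unfolding \<Phi>_def by (simp add: gauss_vec_def sum_distrib_left mult_ac)
    have 2: "\<Phi> (\<lambda>i\<in>I. sqrt s * g i + sqrt h * g' i)
      = lse S \<beta> (\<lambda>\<sigma>. (a \<sigma> + sqrt s * gauss_vec I v g \<sigma>) + sqrt h * gauss_vec I v g' \<sigma>)" for g g'
      unfolding \<Phi>_def by (simp add: gauss_vec_def sum_distrib_left sum.distrib algebra_simps)
    have mR: "(\<lambda>g. \<lambda>i\<in>I. sqrt (s + h) * g i) \<in> ?G \<rightarrow>\<^sub>M ?B"
      by measurable
    have mP: "(\<lambda>(g, g'). \<lambda>i\<in>I. sqrt s * g i + sqrt h * g' i) \<in> ?G \<Otimes>\<^sub>M ?G \<rightarrow>\<^sub>M ?B"
      by measurable
    have "integrable ?G (\<lambda>g. \<Phi> (\<lambda>i\<in>I. sqrt (s + h) * g i))"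
      unfolding 1 by (rule integrable_lse_gauss)
    then have "integrable (distr ?G ?B (\<lambda>g. \<lambda>i\<in>I. sqrt (s + h) * g i)) \<Phi>"
      by (simp add: integrable_distr_eq[OF mR \<Phi>])
    then have "integrable (?G \<Otimes>\<^sub>M ?G) (\<lambda>x. \<Phi> ((\<lambda>(g, g'). \<lambda>i\<in>I. sqrt s * g i + sqrt h * g' i) x))"
      unfolding distr_std_gaussian_add[OF finite_I s h, symmetric] integrable_distr_eq[OF mP \<Phi>] .
    then have int: "integrable (?G \<Otimes>\<^sub>M ?G) (\<lambda>(g, g'). \<Phi> (\<lambda>i\<in>I. sqrt s * g i + sqrt h * g' i))"
      by (simp add: case_prod_unfold)
    have "gauss_mean a (s + h) = integral\<^sup>L (distr ?G ?B (\<lambda>g. \<lambda>i\<in>I. sqrt (s + h) * g i)) \<Phi>"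
      unfolding gauss_mean_def integral_distr[OF mR \<Phi>] 1 ..
    also have "\<dots> = (\<integral>x. \<Phi> ((\<lambda>(g, g'). \<lambda>i\<in>I. sqrt s * g i + sqrt h * g' i) x) \<partial>(?G \<Otimes>\<^sub>M ?G))"
      unfolding distr_std_gaussian_add[OF finite_I s h, symmetric] integral_distr[OF mP \<Phi>] ..
    also have "\<dots> = (\<integral>g. \<integral>g'. \<Phi> (\<lambda>i\<in>I. sqrt s * g i + sqrt h * g' i) \<partial>?G \<partial>?G)"
      using GG.integral_fst'[OF int] by (simp add: case_prod_unfold)
    finally have ?eq unfolding 2 gauss_mean_def .
    moreover have ?int
      using GG.integrable_fst'[OF int] unfolding case_prod_conv 2 gauss_mean_def by simp
    ultimately show ?thesis by blast
  qed
  then show ?eq ?int by auto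
qed

lemma
  shows integrable_gauss_vec: "integrable (std_gaussian I) (\<lambda>g. gauss_vec I v g \<sigma>)"
    and integral_gauss_vec: "(\<integral>g. gauss_vec I v g \<sigma> \<partial>std_gaussian I) = 0"
    and integrable_gauss_vec_mult:
      "integrable (std_gaussian I) (\<lambda>g. gauss_vec I v g \<sigma> * gauss_vec I v g \<tau>)"
    and integral_gauss_vec_mult:
      "(\<integral>g. gauss_vec I v g \<sigma> * gauss_vec I v g \<tau> \<partial>std_gaussian I) = (\<Sum>i\<in>I. v i \<sigma> * v i \<tau>)"
proof -
  show "integrable (std_gaussian I) (\<lambda>g. gauss_vec I v g \<sigma>)"
    unfolding gauss_vec_def
    by (intro Bochner_Integration.integrable_sum integrable_mult_left integrable_std_gaussian_component)
  show "(\<integral>g. gauss_vec I v g \<sigma> \<partial>std_gaussian I) = 0"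
    unfolding gauss_vec_def
    by (subst Bochner_Integration.integral_sum)
       (simp_all add: integrable_std_gaussian_component integral_std_gaussian_component)
  have mult: "gauss_vec I v g \<sigma> * gauss_vec I v g \<tau>
      = (\<Sum>i\<in>I. \<Sum>j\<in>I. g i * g j * (v i \<sigma> * v j \<tau>))" for g
    unfolding gauss_vec_def sum_product by (simp add: mult_ac)
  have int: "integrable (std_gaussian I) (\<lambda>g. g i * g j * (v i \<sigma> * v j \<tau>))" if "i \<in> I" "j \<in> I" for i j
    using integrable_std_gaussian_mult[OF finite_I that] by auto
  show "integrable (std_gaussian I) (\<lambda>g. gauss_vec I v g \<sigma> * gauss_vec I v g \<tau>)"
    unfolding mult using int by (intro Bochner_Integration.integrable_sum)
  have "(\<integral>g. gauss_vec I v g \<sigma> * gauss_vec I v g \<tau> \<partial>std_gaussian I)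
      = (\<Sum>i\<in>I. \<Sum>j\<in>I. \<integral>g. g i * g j * (v i \<sigma> * v j \<tau>) \<partial>std_gaussian I)"
    unfolding mult using int
    by (subst Bochner_Integration.integral_sum, simp add: Bochner_Integration.integrable_sum)
       (auto intro!: sum.cong Bochner_Integration.integral_sum)
  also have "\<dots> = (\<Sum>i\<in>I. \<Sum>j\<in>I. of_bool (i = j) * (v i \<sigma> * v j \<tau>))"
    by (intro sum.cong refl) (simp add: integral_std_gaussian_mult[OF finite_I])
  also have "\<dots> = (\<Sum>i\<in>I. v i \<sigma> * v i \<tau>)"
    using finite_I by (intro sum.cong refl) (simp add: of_bool_def if_distrib if_distribR sum.delta cong: if_cong)
  finally show "(\<integral>g. gauss_vec I v g \<sigma> * gauss_vec I v g \<tau> \<partial>std_gaussian I) = (\<Sum>i\<in>I. v i \<sigma> * v i \<tau>)" .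
qed

text \<open>Integration removes the linear term, as the process is centred, and turns products into
  covariances; the Gibbs weights depend on x alone and leave the integral. The remainder is of order
  h to the power 3/2, with the third moment of the envelope in its constant.\<close>

lemma gauss_mean_expansion:
  fixes x :: "'s \<Rightarrow> real"
  assumes h: "0 \<le> h"
  defines "w \<equiv> gibbs S \<beta> x"
  shows "\<bar>gauss_mean x h - lse S \<beta> x
      - \<beta> * h / 2 * ((\<Sum>\<sigma>\<in>S. w \<sigma> * (\<Sum>i\<in>I. v i \<sigma> * v i \<sigma>))
        - (\<Sum>\<sigma>\<in>S. \<Sum>\<tau>\<in>S. w \<sigma> * w \<tau> * (\<Sum>i\<in>I. v i \<sigma> * v i \<tau>)))\<bar>
    \<le> 100 * \<beta>\<^sup>2 * sqrt h ^ 3 * (\<integral>g. gauss_size g ^ 3 \<partial>std_gaussian I)"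
proof -
  let ?G = "std_gaussian I" and ?Y = "gauss_vec I v"
  interpret G: prob_space ?G by (rule prob_space_std_gaussian)
  define L1 where "L1 g = (\<Sum>\<sigma>\<in>S. w \<sigma> * ?Y g \<sigma>)" for g
  define L2 where "L2 g = (\<Sum>\<sigma>\<in>S. w \<sigma> * (?Y g \<sigma> * ?Y g \<sigma>))" for g
  \<comment> \<open>The squared Gibbs mean is written as a sum over two configurations, so that its
    Gaussian expectation involves only pairwise covariances.\<close>
  define L3 where "L3 g = (\<Sum>\<sigma>\<in>S. \<Sum>\<tau>\<in>S. w \<sigma> * w \<tau> * (?Y g \<sigma> * ?Y g \<tau>))" for g
  define D where "D g = lse S \<beta> (\<lambda>\<sigma>. x \<sigma> + sqrt h * ?Y g \<sigma>) - lse S \<beta> x - sqrt h * L1 g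
    - \<beta> * h / 2 * (L2 g - L3 g)" for g
  have D: "\<bar>D g\<bar> \<le> 100 * \<beta>\<^sup>2 * sqrt h ^ 3 * gauss_size g ^ 3" for g
  proof -
    have "\<bar>lse S \<beta> (\<lambda>\<sigma>. x \<sigma> + sqrt h * ?Y g \<sigma>) - lse S \<beta> x - (\<Sum>\<sigma>\<in>S. w \<sigma> * (sqrt h * ?Y g \<sigma>))
      - \<beta> / 2 * ((\<Sum>\<sigma>\<in>S. w \<sigma> * (sqrt h * ?Y g \<sigma>)\<^sup>2) - (\<Sum>\<sigma>\<in>S. w \<sigma> * (sqrt h * ?Y g \<sigma>))\<^sup>2)\<bar>
      \<le> 100 * \<beta>\<^sup>2 * (sqrt h * gauss_size g) ^ 3"
      unfolding w_def using h
      by (intro lse_add_second_order finite_S S_ne \<beta>_pos)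
        (auto simp: abs_mult gauss_size_nonneg intro!: mult_left_mono abs_gauss_vec_le)
    moreover have "(\<Sum>\<sigma>\<in>S. w \<sigma> * (sqrt h * ?Y g \<sigma>)) = sqrt h * L1 g"
      by (simp add: L1_def sum_distrib_left mult_ac)
    moreover have "(\<Sum>\<sigma>\<in>S. w \<sigma> * (sqrt h * ?Y g \<sigma>)\<^sup>2) = h * L2 g"
      unfolding power_mult_distrib real_sqrt_pow2[OF h]
      by (simp add: L2_def sum_distrib_left power2_eq_square mult_ac)
    moreover have "(sqrt h * L1 g)\<^sup>2 = h * L3 g"
      unfolding power_mult_distrib real_sqrt_pow2[OF h]
      by (simp add: L1_def L3_def power2_eq_square sum_product mult_ac)
    ultimately have le: "\<bar>lse S \<beta> (\<lambda>\<sigma>. x \<sigma> + sqrt h * ?Y g \<sigma>) - lse S \<beta> x - sqrt h * L1 g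
        - \<beta> / 2 * (h * L2 g - h * L3 g)\<bar> \<le> 100 * \<beta>\<^sup>2 * (sqrt h * gauss_size g) ^ 3"
      by simp
    have eq: "\<beta> * h / 2 * (L2 g - L3 g) = \<beta> / 2 * (h * L2 g - h * L3 g)"
      by (simp add: right_diff_distrib)
    show ?thesis
      using le unfolding D_def eq by (simp only: power_mult_distrib mult.assoc)
  qed
  have i0: "integrable ?G (\<lambda>g. lse S \<beta> (\<lambda>\<sigma>. x \<sigma> + sqrt h * ?Y g \<sigma>))"
    by (rule integrable_lse_gauss)
  have i1: "integrable ?G L1" unfolding L1_def using integrable_gauss_vec by auto
  have i2: "integrable ?G L2" unfolding L2_def using integrable_gauss_vec_mult by auto
  have i3: "integrable ?G L3" unfolding L3_def using integrable_gauss_vec_mult by auto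
  have e1: "(\<integral>g. L1 g \<partial>?G) = 0"
    unfolding L1_def using integrable_gauss_vec integral_gauss_vec
    by (subst Bochner_Integration.integral_sum) auto
  have e2: "(\<integral>g. L2 g \<partial>?G) = (\<Sum>\<sigma>\<in>S. w \<sigma> * (\<Sum>i\<in>I. v i \<sigma> * v i \<sigma>))"
    unfolding L2_def using integrable_gauss_vec_mult
    by (subst Bochner_Integration.integral_sum) (auto simp: integral_gauss_vec_mult)
  have e3: "(\<integral>g. L3 g \<partial>?G) = (\<Sum>\<sigma>\<in>S. \<Sum>\<tau>\<in>S. w \<sigma> * w \<tau> * (\<Sum>i\<in>I. v i \<sigma> * v i \<tau>))"
    unfolding L3_def using integrable_gauss_vec_mult
    by (subst Bochner_Integration.integral_sum, simp)
       (auto intro!: sum.cong simp: Bochner_Integration.integral_sum integral_gauss_vec_mult)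
  have iD: "integrable ?G D" unfolding D_def using i0 i1 i2 i3 by auto
  have "(\<integral>g. D g \<partial>?G) = gauss_mean x h - lse S \<beta> x
      - \<beta> * h / 2 * ((\<Sum>\<sigma>\<in>S. w \<sigma> * (\<Sum>i\<in>I. v i \<sigma> * v i \<sigma>))
        - (\<Sum>\<sigma>\<in>S. \<Sum>\<tau>\<in>S. w \<sigma> * w \<tau> * (\<Sum>i\<in>I. v i \<sigma> * v i \<tau>)))"
    unfolding D_def using i0 i1 i2 i3
    by (simp add: e1 e2 e3 gauss_mean_def G.prob_space)
  moreover have "\<bar>\<integral>g. D g \<partial>?G\<bar> \<le> (\<integral>g. 100 * \<beta>\<^sup>2 * sqrt h ^ 3 * gauss_size g ^ 3 \<partial>?G)"
    using D iD integrable_gauss_size_cube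
    by (intro order_trans[OF integral_abs_bound] integral_mono) auto
  ultimately show ?thesis by simp
qed

end

section \<open>Poisson limit of Bernoulli mixtures\<close>

text \<open>With \<open>a k = (T ^^ k) f\<close> and T linear this is the n-th power of (1 - p) id +
  p T applied to f; probabilistically, it is the mean of \<open>a\<close> under a binomial
  law.\<close>

definition bernoulli_mix :: "real \<Rightarrow> (nat \<Rightarrow> real) \<Rightarrow> nat \<Rightarrow> real" where
  "bernoulli_mix p a n = (\<Sum>k\<le>n. real (n choose k) * p ^ k * (1 - p) ^ (n - k) * a k)"

text \<open>Conditioning on one trial; in formulas, Pascal's rule splits the shifted sum.\<close>

lemma bernoulli_mix_Suc:
  "bernoulli_mix p a (Suc n) = (1 - p) * bernoulli_mix p a n + p * bernoulli_mix p (\<lambda>k. a (Suc k)) n"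
proof -
  have "bernoulli_mix p a (Suc n)
    = (1 - p) ^ Suc n * a 0 + (\<Sum>k\<le>n. real (Suc n choose Suc k) * p ^ Suc k * (1 - p) ^ (n - k) * a (Suc k))"
    by (simp add: bernoulli_mix_def sum.atMost_Suc_shift del: binomial_Suc_Suc sum.atMost_Suc)
  also have "(\<Sum>k\<le>n. real (Suc n choose Suc k) * p ^ Suc k * (1 - p) ^ (n - k) * a (Suc k))
    = (\<Sum>k\<le>n. real (n choose Suc k) * p ^ Suc k * (1 - p) ^ (n - k) * a (Suc k))
      + p * bernoulli_mix p (\<lambda>k. a (Suc k)) n"
    by (simp add: bernoulli_mix_def sum_distrib_left sum.distrib[symmetric] algebra_simps)
  also have "(\<Sum>k\<le>n. real (n choose Suc k) * p ^ Suc k * (1 - p) ^ (n - k) * a (Suc k))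
    = (1 - p) * (\<Sum>k<n. real (n choose Suc k) * p ^ Suc k * (1 - p) ^ (n - Suc k) * a (Suc k))"
  proof -
    \<comment> \<open>The term k = n vanishes since \<open>n choose Suc n\<close> is 0. For the
      others n - k = Suc (n - Suc k), which releases a factor 1 - p.\<close>
    have "(\<Sum>k\<le>n. real (n choose Suc k) * p ^ Suc k * (1 - p) ^ (n - k) * a (Suc k))
      = (\<Sum>k<n. real (n choose Suc k) * p ^ Suc k * (1 - p) ^ (n - k) * a (Suc k))"
      by (intro sum.mono_neutral_right) (auto simp: not_less)
    also have "\<dots> = (1 - p) * (\<Sum>k<n. real (n choose Suc k) * p ^ Suc k * (1 - p) ^ (n - Suc k) * a (Suc k))"
      unfolding sum_distrib_left
      by (intro sum.cong refl) (simp add: Suc_diff_Suc[symmetric])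
    finally show ?thesis .
  qed
  also have "(1 - p) ^ Suc n * a 0
      + ((1 - p) * (\<Sum>k<n. real (n choose Suc k) * p ^ Suc k * (1 - p) ^ (n - Suc k) * a (Suc k))
        + p * bernoulli_mix p (\<lambda>k. a (Suc k)) n)
    = (1 - p) * bernoulli_mix p a n + p * bernoulli_mix p (\<lambda>k. a (Suc k)) n"
    by (simp add: bernoulli_mix_def sum.atMost_shift algebra_simps)
  finally show ?thesis .
qed

text \<open>Induction on k through the ratio of consecutive binomial coefficients, (n - k) / (k +
  1).\<close>

lemma binomial_over_power_tendsto:
  "(\<lambda>n. real (n choose k) / real n ^ k) \<longlonglongrightarrow> 1 / fact k"
proof (induction k)
  case (Suc k)
  have "(\<lambda>n. real (n choose k) / real n ^ k * ((1 - real k / real n) / real (Suc k))) \<longlonglongrightarrow> 1 / fact k * ((1 - 0) / real (Suc k))"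
    by (intro tendsto_intros Suc lim_const_over_n) auto
  moreover have "eventually (\<lambda>n. real (n choose k) / real n ^ k * ((1 - real k / real n) / real (Suc k))
      = real (n choose Suc k) / real n ^ Suc k) sequentially"
    using eventually_gt_at_top[of k]
  proof eventually_elim
    case (elim n)
    have "Suc k * (n choose Suc k) = (n - k) * (n choose k)"
      using elim binomial_absorb_comp[of n k] binomial_absorption[of k "n"]
      by (metis binomial_absorption Suc_times_binomial_add diff_Suc_1 nat_mult_1 mult.commute)
    then have "real (Suc k) * real (n choose Suc k) = (real n - real k) * real (n choose k)"
      using elim by (metis of_nat_diff of_nat_mult less_imp_le)
    then have eq: "real (n choose Suc k) = (real n - real k) * real (n choose k) / real (Suc k)"
      by (simp add: field_simps del: of_nat_Suc)
    have "1 - real k / real n = (real n - real k) / real n"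
      using elim by (simp add: field_simps)
    then show ?case unfolding eq by (simp add: mult_ac del: of_nat_Suc)
  qed
  ultimately show ?case by (simp add: Lim_transform_eventually mult.commute)
qed simp

text \<open>Binomial weights converge to Poisson weights term by term, and Tannery's theorem takes
  the limit inside the sum, with the summable majorant lam^k / k! (A + k). Linear growth of
  \<open>a\<close> is what the clause operator will provide, one unit per clause.\<close>

lemma poisson_limit:
  fixes a :: "nat \<Rightarrow> real"
  assumes lam: "0 \<le> lam" and a: "\<And>k. \<bar>a k\<bar> \<le> A + real k"
  shows "(\<lambda>n. bernoulli_mix (lam / real n) a n) \<longlonglongrightarrow> (\<Sum>k. lam ^ k / fact k * exp (- lam) * a k)"
    and "summable (\<lambda>k. norm (lam ^ k / fact k * exp (- lam) * a k))"
proof -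
  define t where "t k n = real (n choose k) * (lam / real n) ^ k * (1 - lam / real n) ^ (n - k) * a k" for k n
  have lim: "(\<lambda>n. t k n) \<longlonglongrightarrow> lam ^ k / fact k * exp (- lam) * a k" for k
  proof -
    have "(\<lambda>n. (1 - lam / real n)) \<longlonglongrightarrow> 1 - 0"
      by (intro tendsto_intros lim_const_over_n)
    then have 1: "(\<lambda>n. (1 - lam / real n) ^ k) \<longlonglongrightarrow> 1 ^ k"
      by (intro tendsto_intros) simp
    have "(\<lambda>n. (1 + (- lam) / real n) ^ n) \<longlonglongrightarrow> exp (- lam)"
      by (rule tendsto_exp_limit_sequentially)
    then have 2: "(\<lambda>n. (1 - lam / real n) ^ n) \<longlonglongrightarrow> exp (- lam)" by simp
    have "(\<lambda>n. lam ^ k * (real (n choose k) / real n ^ k) * ((1 - lam / real n) ^ n / (1 - lam / real n) ^ k) * a k)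
      \<longlonglongrightarrow> lam ^ k * (1 / fact k) * (exp (- lam) / 1 ^ k) * a k"
      by (intro tendsto_mult tendsto_const tendsto_divide 1 2 binomial_over_power_tendsto) simp
    moreover have "eventually (\<lambda>n. lam ^ k * (real (n choose k) / real n ^ k) * ((1 - lam / real n) ^ n / (1 - lam / real n) ^ k) * a k = t k n) sequentially"
      using eventually_gt_at_top[of "max k (nat \<lceil>lam\<rceil>)"]
    proof eventually_elim
      case (elim n)
      then have "k \<le> n" and "lam < real n" by linarith+
      then have "1 - lam / real n \<noteq> 0" using lam by (auto simp: field_simps)
      then show ?case using \<open>k \<le> n\<close> by (simp add: t_def power_diff power_divide)
    qed
    ultimately show ?thesis by (simp add: Lim_transform_eventually)
  qed
  have sumk: "summable (\<lambda>k. lam ^ k / fact k * (A + real k))"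
  proof -
    have s0: "summable (\<lambda>k. lam ^ k / fact k)"
      using summable_exp_generic[of lam] by (simp add: divide_inverse mult.commute)
    have "summable (\<lambda>k. lam ^ Suc k / fact (Suc k) * real (Suc k))"
      using summable_mult[OF s0, of lam] by (simp add: field_simps del: of_nat_Suc)
    then have "summable (\<lambda>k. lam ^ k / fact k * real k)" by (subst (asm) summable_Suc_iff)
    from summable_add[OF summable_mult2[OF s0, of A] this] show ?thesis
      by (simp add: algebra_simps add_divide_distrib)
  qed
  \<comment> \<open>Once n >= lam, the number 1 - lam / n lies in [0, 1] and its powers are at most
    1; the majorant then holds for every k.\<close>
  have "eventually (\<lambda>n. real n \<ge> lam) sequentially"
    by (simp add: eventually_at_top_linorder) (meson real_arch_simple order_trans of_nat_le_iff)
  then have ev: "eventually (\<lambda>(k, n). norm (t k n) \<le> lam ^ k / fact k * (A + real k)) (at_top \<times>\<^sub>F sequentially)"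
    unfolding eventually_prod_filter
  proof (intro exI conjI allI impI)
    show "eventually (\<lambda>_::nat. True) at_top" by simp
    fix k n :: nat assume n: "lam \<le> real n"
    have nn: "0 \<le> 1 - lam / real n" using n lam by (cases "n = 0") (auto simp: field_simps)
    have le1: "(1 - lam / real n) ^ (n - k) \<le> 1" using nn lam by (intro power_le_one) auto
    have A: "0 \<le> A + real k" using a[of k] by linarith
    have "real (n choose k) * (lam / real n) ^ k \<le> lam ^ k / fact k"
    \<comment> \<open>For n = 0 the assumption lam <= n forces lam = 0; for n < k the binomial
      coefficient is 0.\<close>
    proof (cases "n = 0 \<or> n < k")
      case True
      then show ?thesis using lam n by (cases "k = 0") (auto simp: binomial_eq_0)
    next
      case False
      have "real (n choose k) * fact k \<le> real n ^ k"
        using binomial_fact_pow[of n k] by (metis of_nat_le_iff of_nat_mult of_nat_power of_nat_fact)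
      then have "real (n choose k) / real n ^ k \<le> 1 / fact k"
        using False by (simp add: field_simps)
      from mult_left_mono[OF this, of "lam ^ k"] lam show ?thesis
        by (simp add: power_divide mult_ac)
    qed
    then have "real (n choose k) * (lam / real n) ^ k * (1 - lam / real n) ^ (n - k) \<le> lam ^ k / fact k * 1"
      using le1 nn lam by (intro mult_mono) auto
    then have "real (n choose k) * (lam / real n) ^ k * (1 - lam / real n) ^ (n - k) * \<bar>a k\<bar>
      \<le> lam ^ k / fact k * 1 * (A + real k)"
      using a lam by (intro mult_mono[OF _ a]) auto
    then show "case (k, n) of (k, n) \<Rightarrow> norm (t k n) \<le> lam ^ k / fact k * (A + real k)"
      using nn lam by (simp add: t_def abs_mult power_abs)
  qed
  have T: "summable (\<lambda>k. norm (lam ^ k / fact k * exp (- lam) * a k)) \<and>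
    (\<lambda>n. suminf (\<lambda>k. t k n)) \<longlonglongrightarrow> (\<Sum>k. lam ^ k / fact k * exp (- lam) * a k)"
    using tannerys_theorem[OF lim ev sumk] by simp
  moreover have "suminf (\<lambda>k. t k n) = bernoulli_mix (lam / real n) a n" for n
    by (subst suminf_finite[of "{..n}"]) (auto simp: t_def bernoulli_mix_def binomial_eq_0 not_le)
  ultimately show "(\<lambda>n. bernoulli_mix (lam / real n) a n) \<longlonglongrightarrow> (\<Sum>k. lam ^ k / fact k * exp (- lam) * a k)"
    and "summable (\<lambda>k. norm (lam ^ k / fact k * exp (- lam) * a k))" by auto
qed

section \<open>Comparison of compound Poisson and Gaussian vectors\<close>

text \<open>The jump operator of a compound Poisson process: its k-th power averages over k
  independent clauses, and Poisson weights on these powers give the law at a fixed time.\<close>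

definition shift_mean :: "'c pmf \<Rightarrow> ('c \<Rightarrow> 's \<Rightarrow> real) \<Rightarrow> (('s \<Rightarrow> real) \<Rightarrow> real) \<Rightarrow> ('s \<Rightarrow> real) \<Rightarrow> real" where
  "shift_mean c \<theta> f a = measure_pmf.expectation c (\<lambda>x. f (\<lambda>\<sigma>. a \<sigma> - \<theta> x \<sigma>))"

text \<open>Only these moments of a clause enter the comparison. A mean m that is the same at every
  \<sigma> makes the first-order effect of a clause a deterministic shift, so that only second-order
  terms have to be matched by the Gaussian process.\<close>

locale clause_comparison = gaussian_lse S \<beta> I v
  for S :: "'s set" and \<beta> :: real and I :: "'i set" and v :: "'i \<Rightarrow> 's \<Rightarrow> real" +
  fixes c :: "'c pmf" and \<theta> :: "'c \<Rightarrow> 's \<Rightarrow> real" and lam m \<kappa> :: real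
  assumes \<beta>_le: "\<beta> \<le> 1 / 4" and lam_nonneg: "0 \<le> lam"
    and finite_c: "finite (set_pmf c)"
    and \<theta>_01: "\<And>x \<sigma>. x \<in> set_pmf c \<Longrightarrow> \<sigma> \<in> S \<Longrightarrow> \<theta> x \<sigma> = 0 \<or> \<theta> x \<sigma> = 1"
    and \<theta>_mean: "\<And>\<sigma>. \<sigma> \<in> S \<Longrightarrow> measure_pmf.expectation c (\<lambda>x. \<theta> x \<sigma>) = m"
    and \<theta>_cov: "\<And>\<sigma> \<tau>. \<sigma> \<in> S \<Longrightarrow> \<tau> \<in> S \<Longrightarrow>
      lam * measure_pmf.expectation c (\<lambda>x. \<theta> x \<sigma> * \<theta> x \<tau>) = (\<Sum>i\<in>I. v i \<sigma> * v i \<tau>) + \<kappa>"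
begin

lemma integrable_clause[simp]: "integrable (measure_pmf c) (f :: 'c \<Rightarrow> real)"
  by (rule integrable_measure_pmf_finite[OF finite_c])

abbreviation clause_op :: "(('s \<Rightarrow> real) \<Rightarrow> real) \<Rightarrow> ('s \<Rightarrow> real) \<Rightarrow> real" where
  "clause_op \<equiv> shift_mean c \<theta>"

text \<open>First-order approximation of the Poisson semigroup exp (p (T - id)), with T the operator
  \<open>clause_op\<close>. It applies T only once, so a step can be compared with a Gaussian
  increment by a single expansion.\<close>

definition mix_op :: "real \<Rightarrow> (('s \<Rightarrow> real) \<Rightarrow> real) \<Rightarrow> ('s \<Rightarrow> real) \<Rightarrow> real" where
  "mix_op p f a = (1 - p) * f a + p * clause_op f a"

lemma expectation_clause_abs_le:
  fixes f :: "'c \<Rightarrow> real"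
  assumes "\<And>x. x \<in> set_pmf c \<Longrightarrow> \<bar>f x\<bar> \<le> e"
  shows "\<bar>measure_pmf.expectation c f\<bar> \<le> e"
proof -
  have "\<bar>measure_pmf.expectation c f\<bar> \<le> measure_pmf.expectation c (\<lambda>x. \<bar>f x\<bar>)"
    by (rule integral_abs_bound)
  also have "\<dots> \<le> measure_pmf.expectation c (\<lambda>_. e)"
    using assms by (intro integral_mono_AE) (auto simp: AE_measure_pmf_iff)
  finally show ?thesis by simp
qed

text \<open>The 0/1 expansion averaged over the clause. Since the Gibbs weights sum to 1, the Gibbs
  mean \<mu> has expectation m; its square gives a double Gibbs sum, and the error, linear in \<mu>,
  averages to 4 \<beta>^2 m.\<close>

lemma clause_op_lse_expansion:
  fixes x :: "'s \<Rightarrow> real"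
  defines "w \<equiv> gibbs S \<beta> x"
  shows "\<bar>clause_op (lse S \<beta>) x - lse S \<beta> x + m
      - \<beta> / 2 * (m - (\<Sum>\<sigma>\<in>S. \<Sum>\<tau>\<in>S. w \<sigma> * w \<tau> * measure_pmf.expectation c (\<lambda>y. \<theta> y \<sigma> * \<theta> y \<tau>)))\<bar>
    \<le> 4 * \<beta>\<^sup>2 * m"
proof -
  let ?E = "measure_pmf.expectation c"
  define \<mu> where "\<mu> y = (\<Sum>\<sigma>\<in>S. w \<sigma> * \<theta> y \<sigma>)" for y
  define D where "D y = lse S \<beta> (\<lambda>\<sigma>. x \<sigma> - \<theta> y \<sigma>) - lse S \<beta> x + \<mu> y - \<beta> / 2 * (\<mu> y - (\<mu> y)\<^sup>2)" for y
  have D: "\<bar>D y\<bar> \<le> 4 * \<beta>\<^sup>2 * \<mu> y" if "y \<in> set_pmf c" for y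
    unfolding D_def \<mu>_def w_def
    by (rule lse_diff_bernoulli[OF finite_S S_ne \<beta>_pos \<beta>_le \<theta>_01[OF that]])
  have E\<mu>: "?E \<mu> = m"
  proof -
    have "?E \<mu> = (\<Sum>\<sigma>\<in>S. w \<sigma> * m)"
      unfolding \<mu>_def by (subst Bochner_Integration.integral_sum) (auto simp: \<theta>_mean)
    then show ?thesis
      using sum_gibbs[OF finite_S S_ne, of \<beta> x] by (simp add: w_def sum_distrib_right[symmetric])
  qed
  have E\<mu>2: "?E (\<lambda>y. (\<mu> y)\<^sup>2) = (\<Sum>\<sigma>\<in>S. \<Sum>\<tau>\<in>S. w \<sigma> * w \<tau> * ?E (\<lambda>y. \<theta> y \<sigma> * \<theta> y \<tau>))"
  proof -
    have "(\<mu> y)\<^sup>2 = (\<Sum>\<sigma>\<in>S. \<Sum>\<tau>\<in>S. w \<sigma> * w \<tau> * (\<theta> y \<sigma> * \<theta> y \<tau>))" for y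
      unfolding \<mu>_def power2_eq_square sum_product by (simp add: mult_ac)
    then show ?thesis
      by (simp add: Bochner_Integration.integral_sum)
  qed
  have "?E D = clause_op (lse S \<beta>) x - lse S \<beta> x + m
      - \<beta> / 2 * (m - (\<Sum>\<sigma>\<in>S. \<Sum>\<tau>\<in>S. w \<sigma> * w \<tau> * ?E (\<lambda>y. \<theta> y \<sigma> * \<theta> y \<tau>)))"
    unfolding D_def shift_mean_def E\<mu>2[symmetric] E\<mu>[symmetric] by simp
  moreover have "\<bar>?E D\<bar> \<le> ?E (\<lambda>y. 4 * \<beta>\<^sup>2 * \<mu> y)"
    using D by (intro order_trans[OF integral_abs_bound] integral_mono_AE) (auto simp: AE_measure_pmf_iff)
  ultimately show ?thesis using E\<mu> by simp
qed

text \<open>Over 1 / h steps the clause part adds up to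
  \<open>lam * (4 * \<beta>\<^sup>2 * m)\<close>, independent of h, while the Gaussian part is of
  order sqrt h in total.\<close>

definition step_error :: "real \<Rightarrow> real" where
  "step_error h = lam * h * (4 * \<beta>\<^sup>2 * m)
    + 100 * \<beta>\<^sup>2 * sqrt h ^ 3 * (\<integral>g. gauss_size g ^ 3 \<partial>std_gaussian I)"

text \<open>The second-order terms of both expansions agree because \<open>\<theta>\<close> takes values in \<open>{0, 1}\<close>
  and the covariances coincide up to the constant \<open>\<kappa>\<close>, which cancels in a Gibbs variance.\<close>

lemma mix_op_lse:
  assumes h: "0 \<le> h"
  shows "\<bar>mix_op (lam * h) (lse S \<beta>) x - gauss_mean x h + lam * h * m\<bar> \<le> step_error h"
proof -
  let ?E = "measure_pmf.expectation c"
  define w where "w = gibbs S \<beta> x"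
  define Q where "Q = (\<Sum>\<sigma>\<in>S. \<Sum>\<tau>\<in>S. w \<sigma> * w \<tau> * ?E (\<lambda>y. \<theta> y \<sigma> * \<theta> y \<tau>))"
  have w1: "sum w S = 1" unfolding w_def by (rule sum_gibbs[OF finite_S S_ne])
  define d where "d = clause_op (lse S \<beta>) x - lse S \<beta> x + m - \<beta> / 2 * (m - Q)"
  define e where "e = gauss_mean x h - lse S \<beta> x
      - \<beta> * h / 2 * ((\<Sum>\<sigma>\<in>S. w \<sigma> * (\<Sum>i\<in>I. v i \<sigma> * v i \<sigma>))
        - (\<Sum>\<sigma>\<in>S. \<Sum>\<tau>\<in>S. w \<sigma> * w \<tau> * (\<Sum>i\<in>I. v i \<sigma> * v i \<tau>)))"
  have d: "\<bar>d\<bar> \<le> 4 * \<beta>\<^sup>2 * m"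
    unfolding d_def Q_def w_def by (rule clause_op_lse_expansion)
  have e: "\<bar>e\<bar> \<le> 100 * \<beta>\<^sup>2 * sqrt h ^ 3 * (\<integral>g. gauss_size g ^ 3 \<partial>std_gaussian I)"
    unfolding e_def w_def by (rule gauss_mean_expansion[OF h])
  have "(\<Sum>i\<in>I. v i \<sigma> * v i \<sigma>) = lam * m - \<kappa>" if "\<sigma> \<in> S" for \<sigma>
  proof -
    have "?E (\<lambda>y. \<theta> y \<sigma> * \<theta> y \<sigma>) = ?E (\<lambda>y. \<theta> y \<sigma>)"
      using \<theta>_01 that by (intro integral_cong_AE) (auto simp: AE_measure_pmf_iff)
    then show ?thesis using \<theta>_cov[OF that that] \<theta>_mean[OF that] by simp
  qed
  then have 1: "(\<Sum>\<sigma>\<in>S. w \<sigma> * (\<Sum>i\<in>I. v i \<sigma> * v i \<sigma>)) = lam * m - \<kappa>"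
    using w1 by (simp add: sum_distrib_right[symmetric])
  have "(\<Sum>\<sigma>\<in>S. \<Sum>\<tau>\<in>S. w \<sigma> * w \<tau> * (\<Sum>i\<in>I. v i \<sigma> * v i \<tau>))
    = (\<Sum>\<sigma>\<in>S. \<Sum>\<tau>\<in>S. w \<sigma> * w \<tau> * (lam * ?E (\<lambda>y. \<theta> y \<sigma> * \<theta> y \<tau>) - \<kappa>))"
    by (intro sum.cong refl) (simp add: \<theta>_cov)
  also have "\<dots> = lam * Q - sum w S * sum w S * \<kappa>"
    unfolding Q_def
    by (simp add: sum_product sum_distrib_left sum_distrib_right sum_subtractf right_diff_distrib mult_ac)
  finally have 2: "(\<Sum>\<sigma>\<in>S. \<Sum>\<tau>\<in>S. w \<sigma> * w \<tau> * (\<Sum>i\<in>I. v i \<sigma> * v i \<tau>)) = lam * Q - \<kappa>"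
    using w1 by simp
  \<comment> \<open>By 1 and 2 both quadratic terms are \<beta> lam h (m - Q) / 2, so only the two
    remainders are left.\<close>
  have "mix_op (lam * h) (lse S \<beta>) x - gauss_mean x h + lam * h * m = lam * h * d - e"
    unfolding mix_op_def d_def e_def 1 2 by (simp add: field_simps)
  moreover have "\<bar>lam * h * d\<bar> \<le> lam * h * (4 * \<beta>\<^sup>2 * m)"
    using d h lam_nonneg by (simp add: abs_mult mult_left_mono)
  ultimately show ?thesis using e unfolding step_error_def by linarith
qed

text \<open>Both operators average over translations of the starting vector, hence commute. The
  estimate at time 0 is therefore applied at the random point \<open>b g\<close> and integrated; the
  semigroup property identifies the Gaussian side.\<close>

lemma mix_op_gauss_mean:
  assumes s: "0 \<le> s" and h: "0 < h"
  shows "\<bar>mix_op (lam * h) (\<lambda>a. gauss_mean a s) a - gauss_mean a (s + h) + lam * h * m\<bar> \<le> step_error h"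
proof -
  let ?G = "std_gaussian I" and ?E = "measure_pmf.expectation c"
  interpret G: prob_space ?G by (rule prob_space_std_gaussian)
  define b where "b g = (\<lambda>\<sigma>. a \<sigma> + sqrt s * gauss_vec I v g \<sigma>)" for g
  have sum: "?E f = (\<Sum>x\<in>set_pmf c. f x * pmf c x)" for f :: "'c \<Rightarrow> real"
    by (rule integral_measure_pmf_real[OF finite_c]) auto
  have shift: "(\<lambda>\<sigma>. b g \<sigma> - \<theta> x \<sigma>) = (\<lambda>\<sigma>. (a \<sigma> - \<theta> x \<sigma>) + sqrt s * gauss_vec I v g \<sigma>)" for g x
    by (simp add: b_def fun_eq_iff)
  have int1: "integrable ?G (\<lambda>g. clause_op (lse S \<beta>) (b g))"
    unfolding shift_mean_def sum shift
    by (intro Bochner_Integration.integrable_sum integrable_mult_left integrable_lse_gauss)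
  have int0: "integrable ?G (\<lambda>g. lse S \<beta> (b g))"
    unfolding b_def by (rule integrable_lse_gauss)
  have "(\<integral>g. clause_op (lse S \<beta>) (b g) \<partial>?G) = clause_op (\<lambda>a. gauss_mean a s) a"
    unfolding shift_mean_def sum shift gauss_mean_def
    by (subst Bochner_Integration.integral_sum) (auto intro!: integrable_mult_left integrable_lse_gauss)
  then have mix: "(\<integral>g. mix_op (lam * h) (lse S \<beta>) (b g) \<partial>?G) = mix_op (lam * h) (\<lambda>a. gauss_mean a s) a"
    unfolding mix_op_def using int0 int1 by (simp add: gauss_mean_def b_def)
  have intm: "integrable ?G (\<lambda>g. mix_op (lam * h) (lse S \<beta>) (b g))"
    unfolding mix_op_def using int0 int1 by simp
  have intg: "integrable ?G (\<lambda>g. gauss_mean (b g) h)"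
    unfolding b_def by (rule integrable_gauss_mean[OF s h])
  have "(\<integral>g. mix_op (lam * h) (lse S \<beta>) (b g) - gauss_mean (b g) h + lam * h * m \<partial>?G)
    = mix_op (lam * h) (\<lambda>a. gauss_mean a s) a - gauss_mean a (s + h) + lam * h * m"
    using intm intg mix gauss_mean_add[OF s h, of a] by (simp add: b_def G.prob_space)
  moreover have "\<bar>\<integral>g. mix_op (lam * h) (lse S \<beta>) (b g) - gauss_mean (b g) h + lam * h * m \<partial>?G\<bar>
    \<le> (\<integral>g. step_error h \<partial>?G)"
    using intm intg h mix_op_lse
    by (intro order_trans[OF integral_abs_bound] integral_mono) auto
  ultimately show ?thesis by (simp add: G.prob_space)
qed

text \<open>For p in [0, 1] \<open>mix_op\<close> is an averaging operator: it fixes constants and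
  does not enlarge a uniform error. The shift d is there because the centring accumulates over the
  steps.\<close>

lemma mix_op_mono:
  assumes p: "0 \<le> p" "p \<le> 1" and f: "\<And>a. \<bar>f a - f' a + d\<bar> \<le> e"
  shows "\<bar>mix_op p f a - mix_op p f' a + d\<bar> \<le> e"
proof -
  have "clause_op f a - clause_op f' a + d
      = measure_pmf.expectation c (\<lambda>x. f (\<lambda>\<sigma>. a \<sigma> - \<theta> x \<sigma>) - f' (\<lambda>\<sigma>. a \<sigma> - \<theta> x \<sigma>) + d)"
    by (simp add: shift_mean_def)
  then have 1: "\<bar>clause_op f a - clause_op f' a + d\<bar> \<le> e"
    by (simp only:) (intro expectation_clause_abs_le f)
  have "mix_op p f a - mix_op p f' a + d
      = (1 - p) * (f a - f' a + d) + p * (clause_op f a - clause_op f' a + d)"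
    by (simp add: mix_op_def algebra_simps)
  also have "\<bar>\<dots>\<bar> \<le> (1 - p) * e + p * e"
    using p 1 f[of a]
    by (intro order_trans[OF abs_triangle_ineq] add_mono) (auto simp: abs_mult intro!: mult_left_mono)
  finally show ?thesis by (simp add: algebra_simps)
qed

text \<open>Lindeberg's telescoping as an induction: one more Bernoulli step is applied to the
  estimate for n steps, then this step is exchanged for a Gaussian increment at time n h. The
  starting vector is arbitrary since \<open>mix_op\<close> evaluates the estimate at shifted
  vectors.\<close>

lemma mix_op_iterate:
  assumes h: "0 < h" "lam * h \<le> 1"
  shows "\<bar>(mix_op (lam * h) ^^ n) (lse S \<beta>) a - gauss_mean a (real n * h) + real n * (lam * h * m)\<bar>
    \<le> real n * step_error h"
proof (induction n arbitrary: a)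
  case 0
  interpret G: prob_space "std_gaussian I" by (rule prob_space_std_gaussian)
  show ?case by (simp add: gauss_mean_def G.prob_space)
next
  case (Suc n)
  let ?p = "lam * h"
  have "\<bar>mix_op ?p ((mix_op ?p ^^ n) (lse S \<beta>)) a - mix_op ?p (\<lambda>a. gauss_mean a (real n * h)) a
      + real n * (lam * h * m)\<bar> \<le> real n * step_error h"
    using h lam_nonneg by (intro mix_op_mono Suc) auto
  moreover have "\<bar>mix_op ?p (\<lambda>a. gauss_mean a (real n * h)) a - gauss_mean a (real n * h + h) + lam * h * m\<bar>
      \<le> step_error h"
    using h by (intro mix_op_gauss_mean) auto
  moreover have "real n * h + h = real (Suc n) * h" by (simp add: algebra_simps)
  moreover have "real (Suc n) * (lam * h * m) = real n * (lam * h * m) + lam * h * m"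
      "real (Suc n) * step_error h = real n * step_error h + step_error h"
    by (simp_all add: algebra_simps)
  ultimately show ?case by (simp only: funpow.simps o_apply)
qed

lemma clause_op_add:
  "clause_op (\<lambda>a. x * f a + y * f' a) a = x * clause_op f a + y * clause_op f' a"
  by (simp add: shift_mean_def)

text \<open>The binomial theorem for (1 - p) id + p T, whose two parts commute. The induction moves
  one factor onto f, and linearity carries it through the powers of T.\<close>

lemma mix_op_funpow:
  "(mix_op p ^^ n) f a = bernoulli_mix p (\<lambda>k. (clause_op ^^ k) f a) n"
proof (induction n arbitrary: f a)
  case 0
  show ?case by (simp add: bernoulli_mix_def)
next
  case (Suc n)
  have lin: "(clause_op ^^ k) (mix_op p f) a
      = (1 - p) * (clause_op ^^ k) f a + p * (clause_op ^^ Suc k) f a" for k a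
  proof (induction k arbitrary: a)
    case 0
    show ?case by (simp add: mix_op_def)
  next
    case (Suc k)
    then have "(clause_op ^^ k) (mix_op p f)
        = (\<lambda>a. (1 - p) * (clause_op ^^ k) f a + p * (clause_op ^^ Suc k) f a)" by auto
    then show ?case by (simp add: clause_op_add)
  qed
  have "(mix_op p ^^ Suc n) f a = (mix_op p ^^ n) (mix_op p f) a"
    by (simp add: funpow_swap1)
  also have "\<dots> = bernoulli_mix p (\<lambda>k. (clause_op ^^ k) (mix_op p f) a) n" by (rule Suc)
  also have "\<dots> = bernoulli_mix p (\<lambda>k. (clause_op ^^ k) f a) (Suc n)"
    unfolding lin bernoulli_mix_Suc
    by (simp add: bernoulli_mix_def sum_distrib_left sum.distrib[symmetric] algebra_simps)
  finally show ?case .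
qed

text \<open>Subtracting a clause moves \<open>lse\<close> by at most 1, and averaging preserves
  this. The result is the linear growth demanded by the Poisson limit.\<close>

lemma clause_op_funpow_bound:
  "\<bar>(clause_op ^^ k) (lse S \<beta>) a - lse S \<beta> a\<bar> \<le> real k"
proof (induction k arbitrary: a)
  case (Suc k)
  have 1: "\<bar>(clause_op ^^ k) (lse S \<beta>) (\<lambda>\<sigma>. a \<sigma> - \<theta> x \<sigma>) - lse S \<beta> a\<bar> \<le> real (Suc k)"
    if x: "x \<in> set_pmf c" for x
  proof -
    have "\<bar>lse S \<beta> (\<lambda>\<sigma>. a \<sigma> + - \<theta> x \<sigma>) - lse S \<beta> a\<bar> \<le> 1"
    proof (rule lse_add_lipschitz[OF finite_S S_ne \<beta>_pos])
      show "\<bar>- \<theta> x \<sigma>\<bar> \<le> 1" if "\<sigma> \<in> S" for \<sigma> using \<theta>_01[OF x that] by auto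
    qed
    then show ?thesis using Suc[of "\<lambda>\<sigma>. a \<sigma> - \<theta> x \<sigma>"] by simp
  qed
  have "(clause_op ^^ Suc k) (lse S \<beta>) a - lse S \<beta> a
    = measure_pmf.expectation c (\<lambda>x. (clause_op ^^ k) (lse S \<beta>) (\<lambda>\<sigma>. a \<sigma> - \<theta> x \<sigma>) - lse S \<beta> a)"
    by (simp add: shift_mean_def)
  then show ?case using expectation_clause_abs_le[OF 1] by simp
qed simp

text \<open>With h = 1 / n the accumulated error is 4 \<beta>^2 lam m + C / sqrt n. That C depends
  on S, v and \<beta> does no harm, because n tends to infinity with these fixed. Absolute
  summability lets the series be read as a Poisson expectation afterwards.\<close>

lemma poisson_gauss_comparison:
  shows "summable (\<lambda>k. norm (lam ^ k / fact k * exp (- lam) * (clause_op ^^ k) (lse S \<beta>) a))"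
    and "\<bar>(\<Sum>k. lam ^ k / fact k * exp (- lam) * (clause_op ^^ k) (lse S \<beta>) a)
      - gauss_mean a 1 + lam * m\<bar> \<le> 4 * \<beta>\<^sup>2 * (lam * m)"
proof -
  let ?a = "\<lambda>k. (clause_op ^^ k) (lse S \<beta>) a"
  have bound: "\<bar>?a k\<bar> \<le> \<bar>lse S \<beta> a\<bar> + real k" for k
    using clause_op_funpow_bound[of k a] by linarith
  show "summable (\<lambda>k. norm (lam ^ k / fact k * exp (- lam) * ?a k))"
    by (rule poisson_limit(2)[OF lam_nonneg bound])
  define C where "C = 100 * \<beta>\<^sup>2 * (\<integral>g. gauss_size g ^ 3 \<partial>std_gaussian I)"
  have lim: "(\<lambda>n. \<bar>bernoulli_mix (lam / real n) ?a n - gauss_mean a 1 + lam * m\<bar>)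
      \<longlonglongrightarrow> \<bar>(\<Sum>k. lam ^ k / fact k * exp (- lam) * ?a k) - gauss_mean a 1 + lam * m\<bar>"
    by (intro tendsto_intros poisson_limit(1)[OF lam_nonneg bound])
  have "(\<lambda>n. inverse (real n)) \<longlonglongrightarrow> 0" by (rule lim_inverse_n)
  from tendsto_real_sqrt[OF this]
  have sqrt: "(\<lambda>n. sqrt (inverse (real n))) \<longlonglongrightarrow> sqrt 0" .
  have lim2: "(\<lambda>n. lam * (4 * \<beta>\<^sup>2 * m) + C * sqrt (inverse (real n))) \<longlonglongrightarrow> lam * (4 * \<beta>\<^sup>2 * m) + C * sqrt 0"
    by (intro tendsto_add tendsto_mult tendsto_const sqrt)
  have "eventually (\<lambda>n. \<bar>bernoulli_mix (lam / real n) ?a n - gauss_mean a 1 + lam * m\<bar>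
      \<le> lam * (4 * \<beta>\<^sup>2 * m) + C * sqrt (inverse (real n))) sequentially"
    \<comment> \<open>For n > lam the number lam / n is a probability, as the mixture
      requires.\<close>
    using eventually_gt_at_top[of "nat \<lceil>lam\<rceil>"]
  proof eventually_elim
    case (elim n)
    then have n: "lam < real n" "0 < n" by linarith+
    define h where "h = inverse (real n)"
    have h: "0 < h" "lam * h \<le> 1" "real n * h = 1" using n by (auto simp: h_def field_simps)
    have "sqrt h ^ 3 = h * sqrt h"
      using h by (simp add: power3_eq_cube)
    then have "real n * step_error h = lam * (4 * \<beta>\<^sup>2 * m) * (real n * h) + C * (real n * h * sqrt h)"
      unfolding step_error_def C_def by (simp add: algebra_simps)
    moreover have "real n * (lam * h * m) = lam * m" using h(3) by (simp add: mult_ac)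
    moreover have "lam * h = lam / real n" by (simp add: h_def divide_inverse)
    ultimately show ?case
      using mix_op_iterate[OF h(1,2), of n a] h(3) n(2) by (simp add: mix_op_funpow h_def)
  qed
  from tendsto_le[OF _ lim2 lim this]
  show "\<bar>(\<Sum>k. lam ^ k / fact k * exp (- lam) * ?a k) - gauss_mean a 1 + lam * m\<bar> \<le> 4 * \<beta>\<^sup>2 * (lam * m)"
    by (simp add: mult_ac)
qed

end

section \<open>Clauses and disorder\<close>

lemma finite_set_Pi_pmf:
  assumes "finite A" "finite (set_pmf p)"
  shows "finite (set_pmf (Pi_pmf A d (\<lambda>_. p)))"
  using assms by (simp add: set_Pi_pmf finite_PiE_dflt)

lemma expectation_pmf_cong:
  fixes f g :: "'a \<Rightarrow> real"
  assumes "\<And>x. x \<in> set_pmf p \<Longrightarrow> f x = g x"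
  shows "measure_pmf.expectation p f = measure_pmf.expectation p g"
  using assms by (intro integral_cong_AE) (auto simp: AE_measure_pmf_iff)

lemma expectation_pair_pmf_finite:
  fixes f :: "'a \<times> 'b \<Rightarrow> real"
  assumes "finite (set_pmf p)" "finite (set_pmf q)"
  shows "measure_pmf.expectation (pair_pmf p q) f
    = measure_pmf.expectation p (\<lambda>x. measure_pmf.expectation q (\<lambda>y. f (x, y)))"
proof -
  have "measure_pmf.expectation (pair_pmf p q) f
      = (\<Sum>z\<in>set_pmf p \<times> set_pmf q. f z * pmf (pair_pmf p q) z)"
    using assms by (intro integral_measure_pmf_real) auto
  also have "\<dots> = (\<Sum>x\<in>set_pmf p. (\<Sum>y\<in>set_pmf q. f (x, y) * pmf q y) * pmf p x)"
    by (simp add: sum.cartesian_product' pmf_pair sum_distrib_right sum_distrib_left mult_ac)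
  also have "\<dots> = measure_pmf.expectation p (\<lambda>x. measure_pmf.expectation q (\<lambda>y. f (x, y)))"
    using assms by (simp add: integral_measure_pmf_real[where A="set_pmf p"] integral_measure_pmf_real[where A="set_pmf q"])
  finally show ?thesis .
qed

lemma expectation_swap_finite:
  fixes f :: "'a \<Rightarrow> 'b \<Rightarrow> real"
  assumes "finite (set_pmf p)" "finite (set_pmf q)"
  shows "measure_pmf.expectation p (\<lambda>x. measure_pmf.expectation q (f x))
    = measure_pmf.expectation q (\<lambda>y. measure_pmf.expectation p (\<lambda>x. f x y))"
  using assms
  by (simp add: integral_measure_pmf_real[where A="set_pmf p"] integral_measure_pmf_real[where A="set_pmf q"]
      sum_distrib_right)
     (subst sum.swap, simp add: mult_ac)

lemma expectation_pmf_nat: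
  fixes f :: "nat \<Rightarrow> real"
  assumes "summable (\<lambda>k. norm (pmf p k * f k))"
  shows "integrable (measure_pmf p) f"
    and "measure_pmf.expectation p f = (\<Sum>k. pmf p k * f k)"
proof -
  have 1: "integrable (count_space UNIV) (\<lambda>k. pmf p k * f k)"
    using assms by (simp add: integrable_count_space_nat_iff)
  then show "integrable (measure_pmf p) f"
    unfolding measure_pmf_eq_density by (subst integrable_density) auto
  show "measure_pmf.expectation p f = (\<Sum>k. pmf p k * f k)"
    unfolding measure_pmf_eq_density using 1
    by (subst integral_density) (auto simp: integral_count_space_nat)
qed

text \<open>Both laws give a box over J the product of the marginal probabilities, which determines
  a measure on the finite product. Restriction to J removes the coordinates where they differ: d on
  one side, further random coordinates on the other.\<close>

lemma distr_PiM_pmf_restrict: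
  assumes J: "finite J" "J \<subseteq> I"
  shows "distr (\<Pi>\<^sub>M i\<in>I. measure_pmf p) (\<Pi>\<^sub>M i\<in>J. measure_pmf p) (\<lambda>x. restrict x J)
    = distr (measure_pmf (Pi_pmf J d (\<lambda>_. p))) (\<Pi>\<^sub>M i\<in>J. measure_pmf p) (\<lambda>x. restrict x J)"
proof -
  interpret P: product_prob_space "\<lambda>_. measure_pmf p" I
    by standard
  have "distr (measure_pmf (Pi_pmf J d (\<lambda>_. p))) (\<Pi>\<^sub>M i\<in>J. measure_pmf p) (\<lambda>x. restrict x J)
    = (\<Pi>\<^sub>M i\<in>J. measure_pmf p)"
  proof (rule P.PiM_eqI)
    have m: "(\<lambda>x. restrict x J) \<in> measure_pmf (Pi_pmf J d (\<lambda>_. p)) \<rightarrow>\<^sub>M (\<Pi>\<^sub>M i\<in>J. measure_pmf p)"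
      by (auto simp: space_PiM)
    fix A :: "'a \<Rightarrow> 'b set" assume "\<And>i. i \<in> J \<Longrightarrow> A i \<in> sets (measure_pmf p)"
    have "(\<lambda>x. restrict x J) -` (Pi\<^sub>E J A) \<inter> space (measure_pmf (Pi_pmf J d (\<lambda>_. p))) = Pi J A"
      by auto
    then have "emeasure (distr (measure_pmf (Pi_pmf J d (\<lambda>_. p))) (\<Pi>\<^sub>M i\<in>J. measure_pmf p) (\<lambda>x. restrict x J)) (Pi\<^sub>E J A)
      = emeasure (measure_pmf (Pi_pmf J d (\<lambda>_. p))) (Pi J A)"
      using J m by (subst emeasure_distr) (auto intro!: sets_PiM_I_finite)
    also have "\<dots> = ennreal (\<Prod>i\<in>J. measure_pmf.prob p (A i))"
      using J by (simp add: measure_pmf.emeasure_eq_measure measure_Pi_pmf_Pi)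
    also have "\<dots> = (\<Prod>i\<in>J. emeasure (measure_pmf p) (A i))"
      by (simp add: measure_pmf.emeasure_eq_measure prod_ennreal)
    finally show "emeasure (distr (measure_pmf (Pi_pmf J d (\<lambda>_. p))) (\<Pi>\<^sub>M i\<in>J. measure_pmf p) (\<lambda>x. restrict x J)) (Pi\<^sub>E J A)
      = (\<Prod>i\<in>J. emeasure (measure_pmf p) (A i))" .
  qed (use J in auto)
  then show ?thesis using P.distr_PiM_restrict_finite[OF J] by simp
qed

text \<open>For a fixed number of clauses the Hamiltonian reads finitely many coordinates of the
  infinite disorder. With finitely supported marginals, integrals over the disorder thereby become
  finite sums.\<close>

lemma integral_PiM_pmf_restrict:
  fixes f :: "('i \<Rightarrow> 'a) \<Rightarrow> real"
  assumes J: "finite J" "J \<subseteq> I"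
    and f: "f \<in> borel_measurable (\<Pi>\<^sub>M i\<in>J. measure_pmf p)"
    and dep: "\<And>x. f (restrict x J) = f x"
  shows "(\<integral>x. f x \<partial>(\<Pi>\<^sub>M i\<in>I. measure_pmf p)) = measure_pmf.expectation (Pi_pmf J d (\<lambda>_. p)) f"
proof -
  let ?D = "\<lambda>M. distr M (\<Pi>\<^sub>M i\<in>J. measure_pmf p) (\<lambda>x. restrict x J)"
  have m: "(\<lambda>x. restrict x J) \<in> (\<Pi>\<^sub>M i\<in>I. measure_pmf p) \<rightarrow>\<^sub>M (\<Pi>\<^sub>M i\<in>J. measure_pmf p)"
    using J by (intro measurable_restrict_subset)
  have m': "(\<lambda>x. restrict x J) \<in> measure_pmf (Pi_pmf J d (\<lambda>_. p)) \<rightarrow>\<^sub>M (\<Pi>\<^sub>M i\<in>J. measure_pmf p)"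
    by (auto simp: space_PiM)
  have "(\<integral>x. f x \<partial>(\<Pi>\<^sub>M i\<in>I. measure_pmf p)) = integral\<^sup>L (?D (\<Pi>\<^sub>M i\<in>I. measure_pmf p)) f"
    by (simp add: integral_distr[OF m f] dep)
  also have "\<dots> = integral\<^sup>L (?D (measure_pmf (Pi_pmf J d (\<lambda>_. p)))) f"
    by (simp only: distr_PiM_pmf_restrict[OF J, of p d])
  also have "\<dots> = measure_pmf.expectation (Pi_pmf J d (\<lambda>_. p)) f"
    by (simp add: integral_distr[OF m' f] dep)
  finally show ?thesis .
qed

section \<open>Clauses of the K-sat Hamiltonian and the one-clause operator\<close>

definition violated :: "nat \<Rightarrow> (nat \<Rightarrow> nat) \<times> (nat \<Rightarrow> real) \<Rightarrow> (nat \<Rightarrow> real) \<Rightarrow> real" where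
  "violated K = (\<lambda>(u, e) \<sigma>. \<Prod>k\<in>{1..K}. (1 + e k * \<sigma> (u k)) / 2)"

definition ksat_clause :: "nat \<Rightarrow> nat \<Rightarrow> ((nat \<Rightarrow> nat) \<times> (nat \<Rightarrow> real)) pmf" where
  "ksat_clause K N = pair_pmf (Pi_pmf {1..K} 1 (\<lambda>_. pmf_of_set {1..N})) (Pi_pmf {1..K} 1 (\<lambda>_. pmf_of_set {-1, 1}))"

lemma ksat_hamiltonian_Suc:
  "ksat_hamiltonian K (Suc n, i, e) \<sigma>
    = ksat_hamiltonian K (n, i, e) \<sigma> - violated K (\<lambda>k. i (Suc n, k), \<lambda>k. e (Suc n, k)) \<sigma>"
  by (simp add: ksat_hamiltonian_def violated_def)

lemma ksat_hamiltonian_cong: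
  assumes "\<And>j k. j \<in> {1..n} \<Longrightarrow> k \<in> {1..K} \<Longrightarrow> i (j, k) = i' (j, k)"
    and "\<And>j k. j \<in> {1..n} \<Longrightarrow> k \<in> {1..K} \<Longrightarrow> e (j, k) = e' (j, k)"
  shows "ksat_hamiltonian K (n, i, e) = ksat_hamiltonian K (n, i', e')"
  using assms unfolding ksat_hamiltonian_def
  by (auto simp: fun_eq_iff intro!: sum.cong prod.cong)

lemma expectation_Pi_pmf_row:
  fixes f :: "(nat \<Rightarrow> 'a) \<Rightarrow> real"
  shows "measure_pmf.expectation (Pi_pmf ({j} \<times> {1..K}) d (\<lambda>_. p)) (\<lambda>r. f (\<lambda>k. r (j :: nat, k)))
    = measure_pmf.expectation (Pi_pmf {1..K} d (\<lambda>_. p)) f"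
proof -
  have "Pi_pmf {1..K} d (\<lambda>_. p)
      = map_pmf (\<lambda>g. g \<circ> (\<lambda>k. (j, k))) (Pi_pmf ({j} \<times> {1..K}) d (\<lambda>_. p))"
    by (rule Pi_pmf_bij_betw) (auto simp: bij_betw_def inj_on_def)
  then show ?thesis by (simp add: o_def)
qed

text \<open>The last row is made outermost, so that an inductive statement about the first n rows
  applies inside with the last row fixed.\<close>

lemma expectation_Pi_pmf_split:
  fixes f :: "(nat \<times> nat \<Rightarrow> 'a) \<Rightarrow> real"
  assumes p: "finite (set_pmf p)"
  shows "measure_pmf.expectation (Pi_pmf ({1..Suc n} \<times> {1..K}) d (\<lambda>_. p)) f
    = measure_pmf.expectation (Pi_pmf ({Suc n} \<times> {1..K}) d (\<lambda>_. p)) (\<lambda>r.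
        measure_pmf.expectation (Pi_pmf ({1..n} \<times> {1..K}) d (\<lambda>_. p)) (\<lambda>x.
          f (\<lambda>jk. if jk \<in> {1..n} \<times> {1..K} then x jk else r jk)))"
proof -
  let ?A = "{1..n} \<times> {1..K}" and ?B = "{Suc n} \<times> {1..K}"
  have "{1..Suc n} \<times> {1..K} = ?A \<union> ?B" by auto
  then have "measure_pmf.expectation (Pi_pmf ({1..Suc n} \<times> {1..K}) d (\<lambda>_. p)) f
     = measure_pmf.expectation (pair_pmf (Pi_pmf ?A d (\<lambda>_. p)) (Pi_pmf ?B d (\<lambda>_. p)))
        (\<lambda>(x, r). f (\<lambda>jk. if jk \<in> ?A then x jk else r jk))"
    by (simp only:) (subst Pi_pmf_union, auto simp: case_prod_unfold)
  also have "\<dots> = measure_pmf.expectation (Pi_pmf ?A d (\<lambda>_. p)) (\<lambda>x.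
      measure_pmf.expectation (Pi_pmf ?B d (\<lambda>_. p)) (\<lambda>r. f (\<lambda>jk. if jk \<in> ?A then x jk else r jk)))"
    using p by (subst expectation_pair_pmf_finite) (auto intro!: finite_set_Pi_pmf)
  also have "\<dots> = measure_pmf.expectation (Pi_pmf ?B d (\<lambda>_. p)) (\<lambda>r.
      measure_pmf.expectation (Pi_pmf ?A d (\<lambda>_. p)) (\<lambda>x. f (\<lambda>jk. if jk \<in> ?A then x jk else r jk)))"
    using p by (intro expectation_swap_finite finite_set_Pi_pmf) auto
  finally show ?thesis .
qed

text \<open>Clauses are independent and identically distributed, so each contributes one application
  of the same operator. The vector a is general because the induction absorbs the last clause into
  it.\<close>

lemma expectation_ksat_clauses:
  fixes f :: "((nat \<Rightarrow> real) \<Rightarrow> real) \<Rightarrow> real"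
  assumes N: "1 \<le> N"
  shows "measure_pmf.expectation (Pi_pmf ({1..n} \<times> {1..K}) 1 (\<lambda>_. pmf_of_set {1..N})) (\<lambda>i.
      measure_pmf.expectation (Pi_pmf ({1..n} \<times> {1..K}) 1 (\<lambda>_. pmf_of_set {-1, 1})) (\<lambda>e.
        f (\<lambda>\<sigma>. a \<sigma> + ksat_hamiltonian K (n, i, e) \<sigma>)))
    = (shift_mean (ksat_clause K N) (violated K) ^^ n) f a"
proof (induction n arbitrary: a)
  case 0
  have "{1..0::nat} \<times> {1..K} = {}" by simp
  then show ?case by (simp only: pmf_Pi_empty) (simp add: ksat_hamiltonian_def)
next
  case (Suc n)
  let ?p = "pmf_of_set {1..N}" and ?q = "pmf_of_set {-1, 1 :: real}"
  let ?A = "{1..n} \<times> {1..K}" and ?B = "{Suc n} \<times> {1..K}"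
  let ?E = "measure_pmf.expectation"
  let ?mrg = "\<lambda>x r jk. if jk \<in> ?A then x jk else r jk"
  have fin: "finite (set_pmf ?p)" "finite (set_pmf ?q)" using N by auto
  have fins: "finite (set_pmf (Pi_pmf ?A 1 (\<lambda>_. ?p)))" "finite (set_pmf (Pi_pmf ?B 1 (\<lambda>_. ?q)))"
    "finite (set_pmf (Pi_pmf {1..K} 1 (\<lambda>_. ?p)))" "finite (set_pmf (Pi_pmf {1..K} 1 (\<lambda>_. ?q)))"
    using fin by (auto intro!: finite_set_Pi_pmf)
  have H: "f (\<lambda>\<sigma>. a \<sigma> + ksat_hamiltonian K (Suc n, ?mrg i ri, ?mrg e re) \<sigma>)
    = f (\<lambda>\<sigma>. (a \<sigma> - violated K (\<lambda>k. ri (Suc n, k), \<lambda>k. re (Suc n, k)) \<sigma>) + ksat_hamiltonian K (n, i, e) \<sigma>)"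
    for i ri e re
  proof -
    have "ksat_hamiltonian K (n, ?mrg i ri, ?mrg e re) = ksat_hamiltonian K (n, i, e)"
      by (rule ksat_hamiltonian_cong) auto
    then show ?thesis by (simp add: ksat_hamiltonian_Suc algebra_simps)
  qed
  have "?E (Pi_pmf ({1..Suc n} \<times> {1..K}) 1 (\<lambda>_. ?p)) (\<lambda>i.
      ?E (Pi_pmf ({1..Suc n} \<times> {1..K}) 1 (\<lambda>_. ?q)) (\<lambda>e.
        f (\<lambda>\<sigma>. a \<sigma> + ksat_hamiltonian K (Suc n, i, e) \<sigma>)))
    = ?E (Pi_pmf ?B 1 (\<lambda>_. ?p)) (\<lambda>ri. ?E (Pi_pmf ?A 1 (\<lambda>_. ?p)) (\<lambda>i.
        ?E (Pi_pmf ?B 1 (\<lambda>_. ?q)) (\<lambda>re. ?E (Pi_pmf ?A 1 (\<lambda>_. ?q)) (\<lambda>e.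
          f (\<lambda>\<sigma>. (a \<sigma> - violated K (\<lambda>k. ri (Suc n, k), \<lambda>k. re (Suc n, k)) \<sigma>) + ksat_hamiltonian K (n, i, e) \<sigma>)))))"
    unfolding expectation_Pi_pmf_split[OF fin(1)] expectation_Pi_pmf_split[OF fin(2)] H ..
  \<comment> \<open>One exchange puts the indices and signs of the last clause in front of all
    others; the inner pair of expectations is then the induction hypothesis at the shifted
    vector.\<close>
  also have "\<dots> = ?E (Pi_pmf ?B 1 (\<lambda>_. ?p)) (\<lambda>ri. ?E (Pi_pmf ?B 1 (\<lambda>_. ?q)) (\<lambda>re.
        ?E (Pi_pmf ?A 1 (\<lambda>_. ?p)) (\<lambda>i. ?E (Pi_pmf ?A 1 (\<lambda>_. ?q)) (\<lambda>e.
          f (\<lambda>\<sigma>. (a \<sigma> - violated K (\<lambda>k. ri (Suc n, k), \<lambda>k. re (Suc n, k)) \<sigma>) + ksat_hamiltonian K (n, i, e) \<sigma>)))))"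
    by (subst expectation_swap_finite[OF fins(1,2)]) simp
  also have "\<dots> = ?E (Pi_pmf ?B 1 (\<lambda>_. ?p)) (\<lambda>ri. ?E (Pi_pmf ?B 1 (\<lambda>_. ?q)) (\<lambda>re.
      (shift_mean (ksat_clause K N) (violated K) ^^ n) f
        (\<lambda>\<sigma>. a \<sigma> - violated K (\<lambda>k. ri (Suc n, k), \<lambda>k. re (Suc n, k)) \<sigma>)))"
    unfolding Suc ..
  also have "\<dots> = ?E (Pi_pmf ?B 1 (\<lambda>_. ?p)) (\<lambda>ri. ?E (Pi_pmf {1..K} 1 (\<lambda>_. ?q)) (\<lambda>e.
      (shift_mean (ksat_clause K N) (violated K) ^^ n) f
        (\<lambda>\<sigma>. a \<sigma> - violated K (\<lambda>k. ri (Suc n, k), e) \<sigma>)))"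
    by (subst expectation_Pi_pmf_row[where f="\<lambda>e. (shift_mean (ksat_clause K N) (violated K) ^^ n) f
        (\<lambda>\<sigma>. a \<sigma> - violated K (\<lambda>k. _ (Suc n, k), e) \<sigma>)"]) simp
  also have "\<dots> = ?E (Pi_pmf {1..K} 1 (\<lambda>_. ?p)) (\<lambda>u. ?E (Pi_pmf {1..K} 1 (\<lambda>_. ?q)) (\<lambda>e.
      (shift_mean (ksat_clause K N) (violated K) ^^ n) f
        (\<lambda>\<sigma>. a \<sigma> - violated K (u, e) \<sigma>)))"
    by (rule expectation_Pi_pmf_row[where f="\<lambda>u. ?E (Pi_pmf {1..K} 1 (\<lambda>_. ?q)) (\<lambda>e.
      (shift_mean (ksat_clause K N) (violated K) ^^ n) f (\<lambda>\<sigma>. a \<sigma> - violated K (u, e) \<sigma>))"])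
  also have "\<dots> = (shift_mean (ksat_clause K N) (violated K) ^^ Suc n) f a"
  proof -
    have "(shift_mean (ksat_clause K N) (violated K) ^^ Suc n) f a = ?E (ksat_clause K N)
      (\<lambda>x. (shift_mean (ksat_clause K N) (violated K) ^^ n) f (\<lambda>\<sigma>. a \<sigma> - violated K x \<sigma>))"
      by (simp add: shift_mean_def)
    also have "\<dots> = ?E (pair_pmf (Pi_pmf {1..K} 1 (\<lambda>_. ?p)) (Pi_pmf {1..K} 1 (\<lambda>_. ?q)))
      (\<lambda>x. (shift_mean (ksat_clause K N) (violated K) ^^ n) f (\<lambda>\<sigma>. a \<sigma> - violated K x \<sigma>))"
      by (subst (1) ksat_clause_def) (rule refl)
    finally show ?thesis by (simp only: expectation_pair_pmf_finite[OF fins(3,4)])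
  qed
  finally show ?case .
qed

text \<open>The K literals of a clause are independent and identically distributed, so the
  expectation is the K-th power of that of one literal. Signs are averaged first, with the indices
  fixed.\<close>

lemma expectation_ksat_clause_prod:
  fixes \<phi> :: "nat \<Rightarrow> real \<Rightarrow> real"
  assumes N: "1 \<le> N" and nonneg: "\<And>u e. u \<in> {1..N} \<Longrightarrow> e \<in> {-1, 1} \<Longrightarrow> 0 \<le> \<phi> u e"
  shows "measure_pmf.expectation (ksat_clause K N) (\<lambda>(u, e). \<Prod>k\<in>{1..K}. \<phi> (u k) (e k))
    = ((\<Sum>u\<in>{1..N}. (\<phi> u (-1) + \<phi> u 1) / 2) / real N) ^ K"
proof -
  let ?p = "pmf_of_set {1..N}" and ?q = "pmf_of_set {-1, 1 :: real}"
  let ?E = "measure_pmf.expectation"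
  have fin: "finite (set_pmf ?p)" "finite (set_pmf ?q)" using N by auto
  have Eq: "?E ?q (\<lambda>e. \<phi> u e) = (\<phi> u (-1) + \<phi> u 1) / 2" for u
    by (subst integral_pmf_of_set) auto
  have "?E (ksat_clause K N) (\<lambda>(u, e). \<Prod>k\<in>{1..K}. \<phi> (u k) (e k))
    = ?E (Pi_pmf {1..K} 1 (\<lambda>_. ?p)) (\<lambda>u. ?E (Pi_pmf {1..K} 1 (\<lambda>_. ?q)) (\<lambda>e. \<Prod>k\<in>{1..K}. \<phi> (u k) (e k)))"
    unfolding ksat_clause_def using fin
    by (subst expectation_pair_pmf_finite) (auto intro!: finite_set_Pi_pmf)
  also have "\<dots> = ?E (Pi_pmf {1..K} 1 (\<lambda>_. ?p)) (\<lambda>u. \<Prod>k\<in>{1..K}. (\<phi> (u k) (-1) + \<phi> (u k) 1) / 2)"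
  proof (rule expectation_pmf_cong)
    fix u assume "u \<in> set_pmf (Pi_pmf {1..K} 1 (\<lambda>_. ?p))"
    then have u: "u k \<in> {1..N}" if "k \<in> {1..K}" for k
      using that N by (auto simp: set_Pi_pmf PiE_dflt_def)
    have "?E (Pi_pmf {1..K} 1 (\<lambda>_. ?q)) (\<lambda>e. \<Prod>k\<in>{1..K}. \<phi> (u k) (e k)) = (\<Prod>k\<in>{1..K}. ?E ?q (\<phi> (u k)))"
    proof (rule expectation_prod_Pi_pmf)
      show "0 \<le> \<phi> (u k) y" if "k \<in> {1..K}" "y \<in> set_pmf ?q" for k y
        using nonneg[OF u[OF that(1)], of y] that(2) by simp
    qed (auto intro!: integrable_measure_pmf_finite)
    then show "?E (Pi_pmf {1..K} 1 (\<lambda>_. ?q)) (\<lambda>e. \<Prod>k\<in>{1..K}. \<phi> (u k) (e k))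
        = (\<Prod>k\<in>{1..K}. (\<phi> (u k) (-1) + \<phi> (u k) 1) / 2)"
      by (simp only: Eq)
  qed
  also have "\<dots> = (\<Prod>k\<in>{1..K}. ?E ?p (\<lambda>u. (\<phi> u (-1) + \<phi> u 1) / 2))"
    using fin N nonneg by (intro expectation_prod_Pi_pmf) (auto intro!: integrable_measure_pmf_finite add_nonneg_nonneg)
  also have "\<dots> = ((\<Sum>u\<in>{1..N}. (\<phi> u (-1) + \<phi> u 1) / 2) / real N) ^ K"
    using N by (subst integral_pmf_of_set) auto
  finally show ?thesis .
qed

section \<open>Spin configurations and the covariance of the p-spin field\<close>

lemma Max_scale:
  fixes f :: "'a \<Rightarrow> real"
  assumes "finite S" "S \<noteq> {}" "0 \<le> c"
  shows "Max ((\<lambda>x. c * f x) ` S) = c * Max (f ` S)"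
  using mono_Max_commute[of "\<lambda>x. c * x" "f ` S"] assms
  by (simp add: mono_def mult_left_mono image_image)

lemma finite_spin_configs: "finite (spin_configs N)"
  by (simp add: spin_configs_def finite_PiE)

lemma card_spin_configs: "card (spin_configs N) = 2 ^ N"
  by (simp add: spin_configs_def card_PiE numeral_2_eq_2)

lemma spin_configs_ne: "spin_configs N \<noteq> {}"
  using card_spin_configs[of N] by auto

lemma spin_configs_cases: "\<sigma> \<in> spin_configs N \<Longrightarrow> u \<in> {1..N} \<Longrightarrow> \<sigma> u = -1 \<or> \<sigma> u = 1"
  by (auto simp: spin_configs_def PiE_def Pi_def)

lemma lse_spin_configs_Max:
  assumes "0 < \<beta>"
  shows "\<bar>lse (spin_configs N) \<beta> x - Max (x ` spin_configs N)\<bar> \<le> real N * ln 2 / \<beta>"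
  using lse_Max_bounds[OF finite_spin_configs[of N] spin_configs_ne assms, of x]
  by (simp add: card_spin_configs ln_realpow)

lemma finite_multi_indices: "finite (multi_indices N p)"
  unfolding multi_indices_def using finite_lists_length_eq[of "{1..N}" p] by (simp add: conj_commute)

lemma sum_multi_indices:
  fixes f :: "nat \<Rightarrow> real"
  shows "(\<Sum>is\<in>multi_indices N p. prod_list (map f is)) = (\<Sum>u\<in>{1..N}. f u) ^ p"
proof (induction p)
  case 0
  have "multi_indices N 0 = {[]}" by (auto simp: multi_indices_def)
  then show ?case by simp
next
  case (Suc p)
  have eq: "multi_indices N (Suc p) = (\<lambda>(u, is). u # is) ` ({1..N} \<times> multi_indices N p)"
    by (auto simp: multi_indices_def length_Suc_conv image_iff)
  have "(\<Sum>is\<in>multi_indices N (Suc p). prod_list (map f is))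
      = (\<Sum>(u, is)\<in>{1..N} \<times> multi_indices N p. f u * prod_list (map f is))"
    unfolding eq by (subst sum.reindex) (auto simp: inj_on_def case_prod_unfold)
  also have "\<dots> = (\<Sum>u\<in>{1..N}. f u) * (\<Sum>is\<in>multi_indices N p. prod_list (map f is))"
    by (simp add: sum.cartesian_product[symmetric] sum_product)
  finally show ?case using Suc by simp
qed

definition all_multi_indices :: "nat \<Rightarrow> nat \<Rightarrow> nat list set" where
  "all_multi_indices K N = (\<Union>p\<in>{1..K}. multi_indices N p)"

text \<open>The coefficient of \<open>g is\<close> in sqrt \<alpha> / 2 ^ K times the p-spin
  Hamiltonian; the length of the list recovers p. The prefactor makes the covariance that of the
  clause counts up to a constant.\<close>

definition pspin_vec :: "nat \<Rightarrow> nat \<Rightarrow> real \<Rightarrow> nat list \<Rightarrow> (nat \<Rightarrow> real) \<Rightarrow> real" where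
  "pspin_vec K N \<alpha> is \<sigma> = sqrt \<alpha> / 2 ^ K *
    (sqrt (real (K choose length is) * (1 / real N ^ (length is - 1))) * prod_list (map \<sigma> is))"

lemma sum_all_multi_indices:
  fixes f :: "nat list \<Rightarrow> real"
  shows "(\<Sum>is\<in>all_multi_indices K N. f is) = (\<Sum>p\<in>{1..K}. \<Sum>is\<in>multi_indices N p. f is)"
  unfolding all_multi_indices_def
  by (rule sum.UNION_disjoint) (auto simp: finite_multi_indices, auto simp: multi_indices_def)

lemma finite_all_multi_indices: "finite (all_multi_indices K N)"
  by (simp add: all_multi_indices_def finite_multi_indices)

lemma gauss_vec_pspin:
  "gauss_vec (all_multi_indices K N) (pspin_vec K N \<alpha>) g \<sigma> = sqrt \<alpha> / 2 ^ K * pspin_hamiltonian K N g \<sigma>"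
proof -
  have "(\<Sum>is\<in>multi_indices N p. g is * pspin_vec K N \<alpha> is \<sigma>)
    = sqrt \<alpha> / 2 ^ K * (sqrt (real (K choose p) * (1 / real N ^ (p - 1))) *
        (\<Sum>is\<in>multi_indices N p. g is * prod_list (map \<sigma> is)))" for p
    unfolding sum_distrib_left
    by (intro sum.cong refl) (simp add: pspin_vec_def multi_indices_def)
  then show ?thesis
    by (simp add: gauss_vec_def sum_all_multi_indices pspin_hamiltonian_def sum_distrib_left)
qed

lemma prod_list_map_mult:
  fixes f g :: "'a \<Rightarrow> real"
  shows "prod_list (map f xs) * prod_list (map g xs) = prod_list (map (\<lambda>x. f x * g x) xs)"
  by (induction xs) (auto simp: mult_ac)

text \<open>Summing over lists of length p turns the products of spins into R^p, and 1 / N^(p - 1) =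
  N / N^p makes this N (R / N)^p. What remains is a binomial expansion without its term p = 0, the
  source of - 1 / 4 ^ K.\<close>

lemma pspin_vec_cov:
  assumes N: "1 \<le> N" and \<alpha>: "0 \<le> \<alpha>"
  shows "(\<Sum>is\<in>all_multi_indices K N. pspin_vec K N \<alpha> is \<sigma> * pspin_vec K N \<alpha> is \<tau>)
    = \<alpha> * real N * (((1 + (\<Sum>u\<in>{1..N}. \<sigma> u * \<tau> u) / real N) / 4) ^ K - 1 / 4 ^ K)"
proof -
  define R where "R = (\<Sum>u\<in>{1..N}. \<sigma> u * \<tau> u)"
  have "(\<Sum>is\<in>multi_indices N p. pspin_vec K N \<alpha> is \<sigma> * pspin_vec K N \<alpha> is \<tau>)
    = \<alpha> * real N / 4 ^ K * (real (K choose p) * (R / real N) ^ p)" if p: "p \<in> {1..K}" for p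
  proof -
    have "(\<Sum>is\<in>multi_indices N p. pspin_vec K N \<alpha> is \<sigma> * pspin_vec K N \<alpha> is \<tau>)
      = (\<Sum>is\<in>multi_indices N p. \<alpha> / 4 ^ K * (real (K choose p) * (1 / real N ^ (p - 1)))
          * prod_list (map (\<lambda>u. \<sigma> u * \<tau> u) is))"
    proof (intro sum.cong refl)
      fix "is" assume "is \<in> multi_indices N p"
      then have len: "length is = p" by (simp add: multi_indices_def)
      have "pspin_vec K N \<alpha> is \<sigma> * pspin_vec K N \<alpha> is \<tau>
        = (sqrt \<alpha> * sqrt \<alpha>) / (2 ^ K * 2 ^ K) *
          ((sqrt (real (K choose p) * (1 / real N ^ (p - 1))) * sqrt (real (K choose p) * (1 / real N ^ (p - 1))))
          * (prod_list (map \<sigma> is) * prod_list (map \<tau> is)))"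
        by (simp only: pspin_vec_def len) (simp only: times_divide_times_eq[symmetric] mult_ac)
      then show "pspin_vec K N \<alpha> is \<sigma> * pspin_vec K N \<alpha> is \<tau>
        = \<alpha> / 4 ^ K * (real (K choose p) * (1 / real N ^ (p - 1))) * prod_list (map (\<lambda>u. \<sigma> u * \<tau> u) is)"
        using \<alpha> by (simp add: prod_list_map_mult power_mult_distrib[symmetric])
    qed
    also have "\<dots> = \<alpha> / 4 ^ K * (real (K choose p) * (1 / real N ^ (p - 1))) * R ^ p"
      unfolding R_def sum_multi_indices[symmetric] by (simp only: sum_distrib_left)
    \<comment> \<open>This uses p >= 1: at p = 0 truncated subtraction would give 1 instead of
      N.\<close>
    also have "1 / real N ^ (p - 1) = real N / real N ^ p"
      using p N by (cases p) (auto simp: field_simps)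
    finally show ?thesis by (simp add: power_divide)
  qed
  then have "(\<Sum>is\<in>all_multi_indices K N. pspin_vec K N \<alpha> is \<sigma> * pspin_vec K N \<alpha> is \<tau>)
    = \<alpha> * real N / 4 ^ K * (\<Sum>p\<in>{1..K}. real (K choose p) * (R / real N) ^ p)"
    by (simp only: sum_all_multi_indices sum_distrib_left cong: sum.cong)
  also have "(\<Sum>p\<in>{1..K}. real (K choose p) * (R / real N) ^ p) = (1 + R / real N) ^ K - 1"
  proof -
    have "(R / real N + 1) ^ K = (\<Sum>p\<le>K. real (K choose p) * (R / real N) ^ p)"
      by (simp add: binomial_ring)
    also have "{..K} = insert 0 {1..K}" by auto
    finally show ?thesis by (simp add: add.commute)
  qed
  finally show ?thesis by (simp add: R_def power_divide field_simps)
qed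

section \<open>Moments of a random clause\<close>

lemma set_pmf_ksat_clause:
  assumes "1 \<le> N" "(u, e) \<in> set_pmf (ksat_clause K N)" "k \<in> {1..K}"
  shows "u k \<in> {1..N}" "e k = -1 \<or> e k = 1"
  using assms by (auto simp: ksat_clause_def set_Pi_pmf PiE_dflt_def)

lemma prod_zero_or_one:
  fixes f :: "'a \<Rightarrow> real"
  assumes "\<And>x. x \<in> A \<Longrightarrow> f x = 0 \<or> f x = 1"
  shows "prod f A = 0 \<or> prod f A = 1"
  using assms
proof (induction A rule: infinite_finite_induct)
  case (insert x A)
  then have "prod f A = 0 \<or> prod f A = 1" "f x = 0 \<or> f x = 1" by auto
  with insert.hyps show ?case by auto
qed auto

lemma violated_zero_or_one:
  assumes "\<sigma> \<in> spin_configs N"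
    and "\<And>k. k \<in> {1..K} \<Longrightarrow> u k \<in> {1..N}" "\<And>k. k \<in> {1..K} \<Longrightarrow> e k = -1 \<or> e k = 1"
  shows "violated K (u, e) \<sigma> = 0 \<or> violated K (u, e) \<sigma> = 1"
  unfolding violated_def case_prod_conv
proof (rule prod_zero_or_one)
  fix k assume "k \<in> {1..K}"
  with assms(2,3) spin_configs_cases[OF assms(1), of "u k"]
  show "(1 + e k * \<sigma> (u k)) / 2 = 0 \<or> (1 + e k * \<sigma> (u k)) / 2 = 1"
    by fastforce
qed

text \<open>A uniform sign makes each literal violated with probability 1/2 whatever \<sigma> is;
  this is the constant mean m of the abstract comparison.\<close>

lemma expectation_violated:
  assumes "1 \<le> N" "\<sigma> \<in> spin_configs N"
  shows "measure_pmf.expectation (ksat_clause K N) (\<lambda>x. violated K x \<sigma>) = 1 / 2 ^ K"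
proof -
  have "measure_pmf.expectation (ksat_clause K N) (\<lambda>(u, e). \<Prod>k\<in>{1..K}. (1 + e k * \<sigma> (u k)) / 2)
    = ((\<Sum>u\<in>{1..N}. ((1 + (-1) * \<sigma> u) / 2 + (1 + 1 * \<sigma> u) / 2) / 2) / real N) ^ K"
    using assms(1)
  proof (rule expectation_ksat_clause_prod[where \<phi>="\<lambda>u e. (1 + e * \<sigma> u) / 2"])
    fix u e assume "u \<in> {1..N}" "e \<in> {-1, 1 :: real}"
    then show "0 \<le> (1 + e * \<sigma> u) / 2" using spin_configs_cases[OF assms(2), of u] by auto
  qed
  moreover have "((1 + (-1) * s) / 2 + (1 + 1 * s) / 2) / 2 = 1 / 2" for s :: real
    by (simp add: field_simps)
  ultimately show ?thesis
    using assms(1) by (simp only:) (simp add: violated_def case_prod_unfold power_divide)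
qed

text \<open>A literal at u is violated by both configurations with probability 1/2 where they agree
  and never where they differ, that is (1 + \<sigma> u * \<tau> u) / 4; averaging over u brings in
  the overlap.\<close>

lemma expectation_violated_mult:
  assumes "1 \<le> N" "\<sigma> \<in> spin_configs N" "\<tau> \<in> spin_configs N"
  shows "measure_pmf.expectation (ksat_clause K N) (\<lambda>x. violated K x \<sigma> * violated K x \<tau>)
    = ((1 + (\<Sum>u\<in>{1..N}. \<sigma> u * \<tau> u) / real N) / 4) ^ K"
proof -
  define \<phi> where "\<phi> u e = (1 + e * \<sigma> u) / 2 * ((1 + e * \<tau> u) / 2)" for u and e :: real
  have "measure_pmf.expectation (ksat_clause K N) (\<lambda>(u, e). \<Prod>k\<in>{1..K}. \<phi> (u k) (e k))
    = ((\<Sum>u\<in>{1..N}. (\<phi> u (-1) + \<phi> u 1) / 2) / real N) ^ K"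
    using assms(1)
  proof (rule expectation_ksat_clause_prod)
    fix u e assume "u \<in> {1..N}" "e \<in> {-1, 1 :: real}"
    then show "0 \<le> \<phi> u e"
      using spin_configs_cases[OF assms(2), of u] spin_configs_cases[OF assms(3), of u]
      by (auto simp: \<phi>_def)
  qed
  moreover have "(\<phi> u (-1) + \<phi> u 1) / 2 = (1 + \<sigma> u * \<tau> u) / 4" for u
    by (simp add: \<phi>_def field_simps)
  moreover have "(\<Sum>u\<in>{1..N}. (1 + \<sigma> u * \<tau> u) / 4) / real N = (1 + (\<Sum>u\<in>{1..N}. \<sigma> u * \<tau> u) / real N) / 4"
    using assms(1) by (simp add: sum_divide_distrib[symmetric] sum.distrib field_simps)
  moreover have "violated K x \<sigma> * violated K x \<tau> = (case x of (u, e) \<Rightarrow> \<Prod>k\<in>{1..K}. \<phi> (u k) (e k))" for x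
    unfolding violated_def \<phi>_def by (cases x) (simp only: case_prod_conv prod.distrib)
  ultimately show ?thesis by (simp only:)
qed

text \<open>The intensity \<open>\<alpha> * real N\<close> is the mean number of clauses, and the
  constant \<kappa> is the p = 0 term that the p-spin Hamiltonian lacks.\<close>

lemma clause_comparison_ksat:
  assumes N: "1 \<le> N" and \<alpha>: "0 \<le> \<alpha>" and \<beta>: "0 < \<beta>" "\<beta> \<le> 1 / 4"
  shows "clause_comparison (spin_configs N) \<beta> (all_multi_indices K N) (pspin_vec K N \<alpha>)
    (ksat_clause K N) (violated K) (\<alpha> * real N) (1 / 2 ^ K) (\<alpha> * real N * (1 / 4 ^ K))"
proof
  show "finite (set_pmf (ksat_clause K N))"
    using N by (auto simp: ksat_clause_def intro!: finite_cartesian_product finite_set_Pi_pmf)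
  show "violated K x \<sigma> = 0 \<or> violated K x \<sigma> = 1"
    if "x \<in> set_pmf (ksat_clause K N)" "\<sigma> \<in> spin_configs N" for x \<sigma>
    using that set_pmf_ksat_clause[OF N] violated_zero_or_one[OF that(2)] by (cases x) blast
  show "\<alpha> * real N * measure_pmf.expectation (ksat_clause K N) (\<lambda>x. violated K x \<sigma> * violated K x \<tau>)
      = (\<Sum>i\<in>all_multi_indices K N. pspin_vec K N \<alpha> i \<sigma> * pspin_vec K N \<alpha> i \<tau>) + \<alpha> * real N * (1 / 4 ^ K)"
    if "\<sigma> \<in> spin_configs N" "\<tau> \<in> spin_configs N" for \<sigma> \<tau>
    unfolding expectation_violated_mult[OF N that] pspin_vec_cov[OF N \<alpha>] by (simp add: algebra_simps)
qed (use assms in \<open>auto simp: finite_spin_configs spin_configs_ne finite_all_multi_indices expectation_violated\<close>)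

text \<open>At starting vector 0 and time 1 the smooth maximum is that of the scaled Hamiltonian
  itself. Its pointwise distance N ln 2 / \<beta> from the maximum survives integration.\<close>

lemma pspin_comparison:
  assumes N: "1 \<le> N" and \<alpha>: "0 \<le> \<alpha>" and \<beta>: "0 < \<beta>" "\<beta> \<le> 1 / 4"
  shows "\<bar>gaussian_lse.gauss_mean (spin_configs N) \<beta> (all_multi_indices K N) (pspin_vec K N \<alpha>) (\<lambda>_. 0) 1
    - real N * (sqrt \<alpha> / 2 ^ K * expected_pspin_max K N)\<bar> \<le> real N * ln 2 / \<beta>"
proof -
  let ?S = "spin_configs N" and ?G = "std_gaussian (all_multi_indices K N)"
  interpret gaussian_lse ?S \<beta> "all_multi_indices K N" "pspin_vec K N \<alpha>"
    by standard (use \<beta> in \<open>auto simp: finite_spin_configs spin_configs_ne finite_all_multi_indices\<close>)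
  interpret G: prob_space ?G by (rule prob_space_std_gaussian)
  have pd: "pspin_disorder K N = ?G" by (simp add: pspin_disorder_def all_multi_indices_def)
  define X where "X = (\<lambda>g. lse ?S \<beta> (\<lambda>\<sigma>. gauss_vec (all_multi_indices K N) (pspin_vec K N \<alpha>) g \<sigma>))"
  define Y where "Y = (\<lambda>g. real N * (sqrt \<alpha> / 2 ^ K * pspin_max K N g))"
  have XY: "\<bar>X g - Y g\<bar> \<le> real N * ln 2 / \<beta>" for g
  proof -
    have "Y g = Max ((\<lambda>\<sigma>. gauss_vec (all_multi_indices K N) (pspin_vec K N \<alpha>) g \<sigma>) ` ?S)"
    proof -
      have "Y g = (real N * (sqrt \<alpha> / 2 ^ K)) * Max ((\<lambda>\<sigma>. pspin_hamiltonian K N g \<sigma> / real N) ` ?S)"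
        by (simp add: Y_def pspin_max_def)
      also have "\<dots> = Max ((\<lambda>\<sigma>. (real N * (sqrt \<alpha> / 2 ^ K)) * (pspin_hamiltonian K N g \<sigma> / real N)) ` ?S)"
        using \<alpha> by (intro Max_scale[symmetric] finite_spin_configs spin_configs_ne) auto
      also have "(\<lambda>\<sigma>. (real N * (sqrt \<alpha> / 2 ^ K)) * (pspin_hamiltonian K N g \<sigma> / real N))
          = (\<lambda>\<sigma>. gauss_vec (all_multi_indices K N) (pspin_vec K N \<alpha>) g \<sigma>)"
        using N by (simp add: gauss_vec_pspin)
      finally show ?thesis .
    qed
    then show ?thesis unfolding X_def using lse_spin_configs_Max[OF \<beta>(1)] by simp
  qed
  have intX: "integrable ?G X"
    using integrable_lse_gauss[of "\<lambda>_. 0" 1] by (simp add: X_def)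
  have comp: "(\<lambda>g. g is) \<in> borel_measurable ?G" if "is \<in> all_multi_indices K N" for "is"
    using that by measurable
  have [measurable]: "(\<lambda>g. pspin_hamiltonian K N g \<sigma>) \<in> borel_measurable ?G" for \<sigma>
    unfolding pspin_hamiltonian_def
    by (intro borel_measurable_sum borel_measurable_times borel_measurable_const comp)
      (auto simp: all_multi_indices_def)
  have [measurable]: "Y \<in> borel_measurable ?G"
    unfolding Y_def pspin_max_def
    by (intro borel_measurable_times borel_measurable_const borel_measurable_Max finite_spin_configs
        borel_measurable_divide) auto
  \<comment> \<open>Integrability of the maximum is inherited from the smooth maximum, from which it
    has bounded distance.\<close>
  have intY: "integrable ?G Y"
  proof (rule Bochner_Integration.integrable_bound)
    show "integrable ?G (\<lambda>g. \<bar>X g\<bar> + real N * ln 2 / \<beta>)" using intX by auto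
    show "AE g in ?G. norm (Y g) \<le> norm (\<bar>X g\<bar> + real N * ln 2 / \<beta>)"
    proof (intro AE_I2)
      fix g
      show "norm (Y g) \<le> norm (\<bar>X g\<bar> + real N * ln 2 / \<beta>)"
        using XY[of g] unfolding real_norm_def by linarith
    qed
  qed measurable
  have "gauss_mean (\<lambda>_. 0) 1 = (\<integral>g. X g \<partial>?G)"
    by (simp add: gauss_mean_def X_def)
  moreover have "real N * (sqrt \<alpha> / 2 ^ K * expected_pspin_max K N) = (\<integral>g. Y g \<partial>?G)"
    by (simp add: Y_def expected_pspin_max_def pd)
  ultimately have "gauss_mean (\<lambda>_. 0) 1 - real N * (sqrt \<alpha> / 2 ^ K * expected_pspin_max K N) = (\<integral>g. X g - Y g \<partial>?G)"
    by (simp only: Bochner_Integration.integral_diff[OF intX intY])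
  also have "\<bar>\<dots>\<bar> \<le> (\<integral>g. real N * ln 2 / \<beta> \<partial>?G)"
    using intX intY XY by (intro order_trans[OF integral_abs_bound] integral_mono) auto
  finally show ?thesis by (simp add: G.prob_space)
qed

section \<open>Averaging over the K-sat disorder\<close>

abbreviation ksat_index_measure :: "nat \<Rightarrow> (nat \<times> nat \<Rightarrow> nat) measure" where
  "ksat_index_measure N \<equiv> \<Pi>\<^sub>M jk\<in>{1..} \<times> {1..}. measure_pmf (pmf_of_set {1..N})"

abbreviation ksat_sign_measure :: "(nat \<times> nat \<Rightarrow> real) measure" where
  "ksat_sign_measure \<equiv> \<Pi>\<^sub>M jk\<in>{1..} \<times> {1..}. measure_pmf (pmf_of_set {-1, 1})"

lemma prob_space_PiM_pmf: "prob_space (\<Pi>\<^sub>M i\<in>I. measure_pmf p)"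
  by (intro prob_space_PiM measure_pmf.prob_space_axioms)

lemma borel_measurable_ksat_hamiltonian:
  assumes i: "\<And>j k. j \<in> {1..n} \<Longrightarrow> k \<in> {1..K} \<Longrightarrow> (\<lambda>x. i x (j, k)) \<in> M \<rightarrow>\<^sub>M count_space UNIV"
    and e: "\<And>j k. j \<in> {1..n} \<Longrightarrow> k \<in> {1..K} \<Longrightarrow> (\<lambda>x. e x (j, k)) \<in> M \<rightarrow>\<^sub>M count_space UNIV"
  shows "(\<lambda>x. ksat_hamiltonian K (n, i x, e x) \<sigma>) \<in> borel_measurable M"
proof -
  have 1: "(\<lambda>x. \<sigma> (i x (j, k))) \<in> borel_measurable M" if "j \<in> {1..n}" "k \<in> {1..K}" for j k
    by (rule measurable_compose[OF i[OF that]]) simp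
  have 2: "(\<lambda>x. e x (j, k)) \<in> borel_measurable M" if "j \<in> {1..n}" "k \<in> {1..K}" for j k
    by (rule measurable_compose[OF e[OF that]]) simp
  show ?thesis
    unfolding ksat_hamiltonian_def case_prod_conv
    by (intro borel_measurable_uminus borel_measurable_sum borel_measurable_prod borel_measurable_divide
        borel_measurable_add borel_measurable_times borel_measurable_const 1 2)
qed

lemma measurable_PiM_pmf_component:
  assumes "j \<in> J"
  shows "(\<lambda>x. x j) \<in> (\<Pi>\<^sub>M i\<in>J. measure_pmf p) \<rightarrow>\<^sub>M count_space UNIV"
  using measurable_component_singleton[OF assms, of "\<lambda>_. measure_pmf p"] by simp

text \<open>Coordinates in the product space may take any value of their type, so the ranges of
  indices and signs hold only almost surely. Countability of the index set lets the null sets of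
  single coordinates be united.\<close>

lemma AE_ksat_disorder:
  assumes N: "1 \<le> N"
  shows "AE x in ksat_index_measure N \<Otimes>\<^sub>M ksat_sign_measure.
    \<forall>jk\<in>{1..} \<times> {1..}. fst x jk \<in> {1..N} \<and> (snd x jk = -1 \<or> snd x jk = 1)"
proof -
  let ?PI = "ksat_index_measure N" and ?PE = "ksat_sign_measure"
  interpret PE: prob_space ?PE by (rule prob_space_PiM_pmf)
  have "AE i in ?PI. \<forall>jk\<in>{1..} \<times> {1..}. i jk \<in> {1..N}"
    using N by (intro AE_ball_countable' AE_PiM_component measure_pmf.prob_space_axioms)
      (auto simp: AE_measure_pmf_iff)
  then have "AE i in distr (?PI \<Otimes>\<^sub>M ?PE) ?PI fst. \<forall>jk\<in>{1..} \<times> {1..}. i jk \<in> {1..N}"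
    by (simp only: PE.distr_pair_fst)
  then have 1: "AE x in ?PI \<Otimes>\<^sub>M ?PE. \<forall>jk\<in>{1..} \<times> {1..}. fst x jk \<in> {1..N}"
    by (rule AE_distrD[rotated]) measurable
  have "AE e in ?PE. \<forall>jk\<in>{1..} \<times> {1..}. e jk = -1 \<or> e jk = 1"
    by (intro AE_ball_countable' AE_PiM_component measure_pmf.prob_space_axioms)
      (auto simp: AE_measure_pmf_iff)
  then have "AE e in distr (?PI \<Otimes>\<^sub>M ?PE) ?PE snd. \<forall>jk\<in>{1..} \<times> {1..}. e jk = -1 \<or> e jk = 1"
    by (simp only: distr_pair_snd[OF prob_space_PiM_pmf prob_space_PiM_pmf])
  then have "AE x in ?PI \<Otimes>\<^sub>M ?PE. \<forall>jk\<in>{1..} \<times> {1..}. snd x jk = -1 \<or> snd x jk = 1"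
    by (rule AE_distrD[rotated]) measurable
  with 1 show ?thesis by eventually_elim auto
qed

lemma abs_ksat_hamiltonian_le:
  assumes "\<sigma> \<in> spin_configs N"
    and "\<And>j k. j \<in> {1..n} \<Longrightarrow> k \<in> {1..K} \<Longrightarrow> i (j, k) \<in> {1..N} \<and> (e (j, k) = -1 \<or> e (j, k) = 1)"
  shows "\<bar>ksat_hamiltonian K (n, i, e) \<sigma>\<bar> \<le> real n"
proof -
  have "\<bar>ksat_hamiltonian K (n, i, e) \<sigma>\<bar> \<le> (\<Sum>j\<in>{1..n}. \<bar>violated K (\<lambda>k. i (j, k), \<lambda>k. e (j, k)) \<sigma>\<bar>)"
    by (simp add: ksat_hamiltonian_def violated_def sum_abs)
  also have "\<dots> \<le> (\<Sum>j\<in>{1..n}. 1)"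
  proof (rule sum_mono)
    fix j assume "j \<in> {1..n}"
    then show "\<bar>violated K (\<lambda>k. i (j, k), \<lambda>k. e (j, k)) \<sigma>\<bar> \<le> 1"
      using violated_zero_or_one[OF assms(1), of K "\<lambda>k. i (j, k)" "\<lambda>k. e (j, k)"] assms(2)[of j] by fastforce
  qed
  finally show ?thesis by simp
qed

text \<open>The argument conditions on the number n of clauses: the smooth maximum has conditional
  mean \<open>L n\<close>, and its pointwise distance from the maximum is preserved by averaging
  over clauses and then over the Poisson variable. The series is the Poisson mean of L.\<close>

lemma ksat_comparison:
  fixes K :: nat
  assumes N: "1 \<le> N" and \<alpha>: "0 < \<alpha>" and \<beta>: "0 < \<beta>"
  defines "L \<equiv> \<lambda>n. (shift_mean (ksat_clause K N) (violated K) ^^ n) (lse (spin_configs N) \<beta>) (\<lambda>_. 0)"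
  assumes sumL: "summable (\<lambda>n. norm ((\<alpha> * real N) ^ n / fact n * exp (- (\<alpha> * real N)) * L n))"
  shows "\<bar>real N * expected_ksat_max K N \<alpha> - (\<Sum>n. (\<alpha> * real N) ^ n / fact n * exp (- (\<alpha> * real N)) * L n)\<bar>
    \<le> real N * ln 2 / \<beta>"
proof -
  let ?S = "spin_configs N" and ?PI = "ksat_index_measure N" and ?PE = "ksat_sign_measure"
  let ?Q = "?PI \<Otimes>\<^sub>M ?PE"
  define P where "P = poisson_pmf (\<alpha> * real N)"
  let ?D = "measure_pmf P \<Otimes>\<^sub>M ?Q"
  have lam: "0 < \<alpha> * real N" using N \<alpha> by simp
  interpret PI: prob_space ?PI by (rule prob_space_PiM_pmf)
  interpret PE: prob_space ?PE by (rule prob_space_PiM_pmf)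
  interpret Q: pair_prob_space ?PI ?PE ..
  interpret D: pair_prob_space "measure_pmf P" ?Q ..
  define Y where "Y = (\<lambda>\<omega>. real N * ksat_max K N \<omega>)"
  define X where "X = (\<lambda>n (i, e). lse ?S \<beta> (\<lambda>\<sigma>. ksat_hamiltonian K (n, i, e) \<sigma>))"
  have Y_Max: "Y \<omega> = Max (ksat_hamiltonian K \<omega> ` ?S)" for \<omega>
  proof -
    have "Y \<omega> = Max ((\<lambda>\<sigma>. real N * (ksat_hamiltonian K \<omega> \<sigma> / real N)) ` ?S)"
      unfolding Y_def ksat_max_def by (intro Max_scale[symmetric] finite_spin_configs spin_configs_ne) simp
    then show ?thesis using N by simp
  qed
  have XY: "\<bar>X n x - Y (n, x)\<bar> \<le> real N * ln 2 / \<beta>" for n x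
    unfolding Y_Max X_def using lse_spin_configs_Max[OF \<beta>] by (simp add: case_prod_unfold)

  have mH: "(\<lambda>x. ksat_hamiltonian K (n, fst x, snd x) \<sigma>) \<in> borel_measurable ?Q" for n \<sigma>
    by (intro borel_measurable_ksat_hamiltonian measurable_compose[OF measurable_fst measurable_PiM_pmf_component]
        measurable_compose[OF measurable_snd measurable_PiM_pmf_component]) auto
  have mX: "X n \<in> borel_measurable ?Q" for n
  proof -
    note mH[measurable]
    show ?thesis unfolding X_def lse_def case_prod_unfold by measurable
  qed
  have mY: "(\<lambda>x. Y (n, x)) \<in> borel_measurable ?Q" for n
    unfolding Y_Max using mH
    by (intro borel_measurable_Max finite_spin_configs) (simp add: case_prod_unfold)
  have mYD: "Y \<in> borel_measurable ?D"
  proof -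
    \<comment> \<open>Since the first factor is countable, measurability at every fixed n yields
      joint measurability.\<close>
    have "Y \<in> borel_measurable (count_space UNIV \<Otimes>\<^sub>M ?Q)"
      by (rule measurable_pair_measure_countable1[OF _ mY]) simp
    then show ?thesis by (simp cong: measurable_cong_sets sets_pair_measure_cong)
  qed
  have absY: "\<bar>Y (n, x)\<bar> \<le> real n"
    if "\<forall>jk\<in>{1..} \<times> {1..}. fst x jk \<in> {1..N} \<and> (snd x jk = -1 \<or> snd x jk = 1)" for n x
  proof -
    have "\<bar>ksat_hamiltonian K (n, x) \<sigma>\<bar> \<le> real n" if "\<sigma> \<in> ?S" for \<sigma>
      using abs_ksat_hamiltonian_le[OF that, of n K "fst x" "snd x"]
        \<open>\<forall>jk\<in>_. _\<close> by simp
    moreover have "Y (n, x) \<in> ksat_hamiltonian K (n, x) ` ?S"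
      unfolding Y_Max using finite_spin_configs spin_configs_ne by (intro Max_in) auto
    ultimately show ?thesis by auto
  qed
  have intYn: "integrable ?Q (\<lambda>x. Y (n, x))" for n
    using AE_ksat_disorder[OF N] absY
    by (intro Q.integrable_const_bound[where B="real n"] mY) (auto elim: eventually_mono)
  have intXn: "integrable ?Q (X n)" for n
  proof (rule Bochner_Integration.integrable_bound[OF _ mX])
    show "integrable ?Q (\<lambda>x. \<bar>Y (n, x)\<bar> + real N * ln 2 / \<beta>)"
      by (intro Bochner_Integration.integrable_add integrable_abs intYn Q.integrable_const)
    show "AE x in ?Q. norm (X n x) \<le> norm (\<bar>Y (n, x)\<bar> + real N * ln 2 / \<beta>)"
    proof (intro AE_I2)
      fix x
      show "norm (X n x) \<le> norm (\<bar>Y (n, x)\<bar> + real N * ln 2 / \<beta>)"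
        using XY[of n x] unfolding real_norm_def by linarith
    qed
  qed

  \<comment> \<open>With \<open>a = real\<close> and A = 0 the Poisson limit supplies the first
    moment of the Poisson law; the number of clauses dominates |Y| almost surely.\<close>
  have "summable (\<lambda>n. norm ((\<alpha> * real N) ^ n / fact n * exp (- (\<alpha> * real N)) * real n))"
    using lam by (intro poisson_limit(2)[of _ _ 0]) auto
  then have int_nat: "integrable (measure_pmf P) real"
    by (intro expectation_pmf_nat(1)) (simp add: P_def lam)
  have "integrable (distr ?D (measure_pmf P) fst) real"
    using int_nat Q.distr_pair_fst[of "measure_pmf P"] by simp
  then have int_fst: "integrable ?D (\<lambda>x. real (fst x))"
    by (rule integrable_distr[rotated]) simp
  have intY: "integrable ?D Y"
  proof (rule Bochner_Integration.integrable_bound[OF int_fst mYD])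
    have "AE x in distr ?D ?Q snd. \<forall>jk\<in>{1..} \<times> {1..}. fst x jk \<in> {1..N} \<and> (snd x jk = -1 \<or> snd x jk = 1)"
      using AE_ksat_disorder[OF N]
      by (simp only: distr_pair_snd[OF measure_pmf.prob_space_axioms Q.prob_space_axioms])
    then have "AE \<omega> in ?D. \<forall>jk\<in>{1..} \<times> {1..}. fst (snd \<omega>) jk \<in> {1..N} \<and> (snd (snd \<omega>) jk = -1 \<or> snd (snd \<omega>) jk = 1)"
      by (rule AE_distrD[rotated]) measurable
    then show "AE \<omega> in ?D. norm (Y \<omega>) \<le> norm (real (fst \<omega>))"
    proof eventually_elim
      case (elim \<omega>)
      from absY[OF this, of "fst \<omega>"] show ?case by simp
    qed
  qed

  have EX: "(\<integral>x. X n x \<partial>?Q) = L n" for n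
  proof -
    let ?J = "{1..n} \<times> {1..K}" and ?p = "pmf_of_set {1..N}" and ?q = "pmf_of_set {-1, 1 :: real}"
    have J: "finite ?J" "?J \<subseteq> {1..} \<times> {1..}" by auto
    have finq: "finite (set_pmf (Pi_pmf ?J 1 (\<lambda>_. ?q)))" by (intro finite_set_Pi_pmf) auto
    have lse_meas: "(\<lambda>x. X n (i x, e x)) \<in> borel_measurable M"
      if "\<And>\<sigma>. (\<lambda>x. ksat_hamiltonian K (n, i x, e x) \<sigma>) \<in> borel_measurable M" for M :: "'z measure" and i e
    proof -
      note that[measurable]
      show ?thesis unfolding X_def lse_def case_prod_conv by measurable
    qed
    have restrict_e: "X n (i, restrict e ?J) = X n (i, e)" for i e
      unfolding X_def case_prod_conv by (subst ksat_hamiltonian_cong[where i'=i and e'=e]) auto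
    have restrict_i: "X n (restrict i ?J, e) = X n (i, e)" for i e
      unfolding X_def case_prod_conv by (subst ksat_hamiltonian_cong[where i'=i and e'=e]) auto
    have Ee: "(\<integral>e. X n (i, e) \<partial>?PE) = measure_pmf.expectation (Pi_pmf ?J 1 (\<lambda>_. ?q)) (\<lambda>e. X n (i, e))" for i
    proof (rule integral_PiM_pmf_restrict[OF J])
      show "(\<lambda>e. X n (i, e)) \<in> borel_measurable (\<Pi>\<^sub>M i\<in>?J. measure_pmf ?q)"
        by (intro lse_meas borel_measurable_ksat_hamiltonian measurable_PiM_pmf_component measurable_const) auto
    qed (rule restrict_e)
    have "(\<integral>x. X n x \<partial>?Q) = (\<integral>i. \<integral>e. X n (i, e) \<partial>?PE \<partial>?PI)"
      using Q.integral_fst'[OF intXn] by simp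
    also have "\<dots> = (\<integral>i. measure_pmf.expectation (Pi_pmf ?J 1 (\<lambda>_. ?q)) (\<lambda>e. X n (i, e)) \<partial>?PI)"
      by (simp only: Ee)
    also have "\<dots> = measure_pmf.expectation (Pi_pmf ?J 1 (\<lambda>_. ?p)) (\<lambda>i.
        measure_pmf.expectation (Pi_pmf ?J 1 (\<lambda>_. ?q)) (\<lambda>e. X n (i, e)))"
    proof (rule integral_PiM_pmf_restrict[OF J])
      \<comment> \<open>As a finite sum over sign patterns, the inner expectation is measurable in
        the indices.\<close>
      have "measure_pmf.expectation (Pi_pmf ?J 1 (\<lambda>_. ?q)) (\<lambda>e. X n (i, e))
        = (\<Sum>e\<in>set_pmf (Pi_pmf ?J 1 (\<lambda>_. ?q)). X n (i, e) * pmf (Pi_pmf ?J 1 (\<lambda>_. ?q)) e)" for i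
        by (rule integral_measure_pmf_real[OF finq]) auto
      then show "(\<lambda>i. measure_pmf.expectation (Pi_pmf ?J 1 (\<lambda>_. ?q)) (\<lambda>e. X n (i, e)))
          \<in> borel_measurable (\<Pi>\<^sub>M i\<in>?J. measure_pmf ?p)"
        by (simp only:) (intro borel_measurable_sum borel_measurable_times borel_measurable_const lse_meas
            borel_measurable_ksat_hamiltonian measurable_PiM_pmf_component measurable_const; simp)
    qed (simp only: restrict_i)
    also have "\<dots> = L n"
      unfolding L_def X_def case_prod_conv
      using expectation_ksat_clauses[OF N, of n K "lse ?S \<beta>" "\<lambda>_. 0"] by simp
    finally show ?thesis .
  qed

  have disorder: "ksat_disorder N \<alpha> = ?D" by (simp add: ksat_disorder_def P_def)
  have "real N * expected_ksat_max K N \<alpha> = (\<integral>\<omega>. Y \<omega> \<partial>?D)"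
    by (simp add: expected_ksat_max_def Y_def disorder)
  also have "\<dots> = measure_pmf.expectation P (\<lambda>n. \<integral>x. Y (n, x) \<partial>?Q)"
    using D.integral_fst'[OF intY] by simp
  finally have EY: "real N * expected_ksat_max K N \<alpha> = measure_pmf.expectation P (\<lambda>n. \<integral>x. Y (n, x) \<partial>?Q)" .
  have intEY: "integrable (measure_pmf P) (\<lambda>n. \<integral>x. Y (n, x) \<partial>?Q)"
    using D.integrable_fst'[OF intY] by simp
  have sumL': "summable (\<lambda>n. norm (pmf P n * L n))"
    using sumL by (simp add: P_def lam)
  have EL: "measure_pmf.expectation P L = (\<Sum>n. (\<alpha> * real N) ^ n / fact n * exp (- (\<alpha> * real N)) * L n)"
    using expectation_pmf_nat(2)[OF sumL'] by (simp add: P_def lam)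
  have "\<bar>(\<integral>x. Y (n, x) \<partial>?Q) - L n\<bar> \<le> real N * ln 2 / \<beta>" for n
  proof -
    have "(\<integral>x. Y (n, x) \<partial>?Q) - L n = (\<integral>x. Y (n, x) - X n x \<partial>?Q)"
      by (simp only: EX[symmetric] Bochner_Integration.integral_diff[OF intYn intXn])
    also have "\<bar>\<dots>\<bar> \<le> (\<integral>x. real N * ln 2 / \<beta> \<partial>?Q)"
      by (intro order_trans[OF integral_abs_bound] integral_mono integrable_abs
          Bochner_Integration.integrable_diff intYn intXn Q.integrable_const)
        (subst abs_minus_commute, rule XY)
    finally show ?thesis by (simp only: lebesgue_integral_const Q.prob_space scaleR_one)
  qed
  then have "(\<integral>n. \<bar>(\<integral>x. Y (n, x) \<partial>?Q) - L n\<bar> \<partial>measure_pmf P) \<le> (\<integral>n. real N * ln 2 / \<beta> \<partial>measure_pmf P)"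
    using intEY expectation_pmf_nat(1)[OF sumL'] by (intro integral_mono) auto
  then have "\<bar>measure_pmf.expectation P (\<lambda>n. (\<integral>x. Y (n, x) \<partial>?Q) - L n)\<bar> \<le> real N * ln 2 / \<beta>"
    by (intro order_trans[OF integral_abs_bound]) simp
  then show ?thesis
    using intEY expectation_pmf_nat(1)[OF sumL'] by (simp add: EY EL)
qed

text \<open>The threshold 64 = 4^3 is what \<beta> <= 1/4 demands of \<beta> = \<alpha>^(-1/3). The
  coefficient obtained, 2 ln 2 + 4 / 2^K, is at most 6, so the same number 64 can serve both as
  threshold and as factor, as the theorem asks of its single constant.\<close>

lemma expected_ksat_max_bound:
  assumes N: "1 \<le> N" and \<alpha>: "64 \<le> \<alpha>"
  shows "\<bar>expected_ksat_max K N \<alpha> - (- (\<alpha> / 2 ^ K) + sqrt \<alpha> / 2 ^ K * expected_pspin_max K N)\<bar>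
    \<le> 64 * \<alpha> powr (1 / 3)"
proof -
  define \<beta> where "\<beta> = \<alpha> powr (- (1 / 3))"
  have \<alpha>0: "0 < \<alpha>" using \<alpha> by simp
  have \<beta>0: "0 < \<beta>" using \<alpha>0 by (simp add: \<beta>_def)
  have "\<beta> \<le> 64 powr (- (1 / 3))" unfolding \<beta>_def using \<alpha> by (intro powr_mono2') auto
  also have "(64 :: real) powr (- (1 / 3)) = (4 powr 3) powr (- (1 / 3))" by simp
  also have "\<dots> = 1 / 4" by (subst powr_powr) (simp add: powr_minus_divide)
  finally have \<beta>1: "\<beta> \<le> 1 / 4" .
  have inv: "1 / \<beta> = \<alpha> powr (1 / 3)" by (simp add: \<beta>_def powr_minus_divide)
  have sq: "\<beta>\<^sup>2 * \<alpha> = \<alpha> powr (1 / 3)"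
  proof -
    have "\<beta>\<^sup>2 * \<alpha> = \<alpha> powr (- (1 / 3)) * \<alpha> powr (- (1 / 3)) * \<alpha> powr 1"
      using \<alpha>0 by (simp add: \<beta>_def power2_eq_square)
    also have "\<dots> = \<alpha> powr (1 / 3)" by (simp only: powr_add[symmetric]) simp
    finally show ?thesis .
  qed
  interpret clause_comparison "spin_configs N" \<beta> "all_multi_indices K N" "pspin_vec K N \<alpha>"
    "ksat_clause K N" "violated K" "\<alpha> * real N" "1 / 2 ^ K" "\<alpha> * real N * (1 / 4 ^ K)"
    using clause_comparison_ksat[OF N _ \<beta>0 \<beta>1] \<alpha>0 by simp
  define T where "T = (\<Sum>n. (\<alpha> * real N) ^ n / fact n * exp (- (\<alpha> * real N))
    * (clause_op ^^ n) (lse (spin_configs N) \<beta>) (\<lambda>_. 0))"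
  have 1: "\<bar>real N * expected_ksat_max K N \<alpha> - T\<bar> \<le> real N * ln 2 / \<beta>"
    unfolding T_def by (rule ksat_comparison[OF N \<alpha>0 \<beta>0 poisson_gauss_comparison(1)])
  have 2: "\<bar>T - gauss_mean (\<lambda>_. 0) 1 + \<alpha> * real N * (1 / 2 ^ K)\<bar> \<le> 4 * \<beta>\<^sup>2 * (\<alpha> * real N * (1 / 2 ^ K))"
    unfolding T_def by (rule poisson_gauss_comparison(2))
  have 3: "\<bar>gauss_mean (\<lambda>_. 0) 1 - real N * (sqrt \<alpha> / 2 ^ K * expected_pspin_max K N)\<bar> \<le> real N * ln 2 / \<beta>"
    using \<alpha>0 by (intro pspin_comparison N \<beta>0 \<beta>1) simp
  define R where "R = expected_ksat_max K N \<alpha> - (- (\<alpha> / 2 ^ K) + sqrt \<alpha> / 2 ^ K * expected_pspin_max K N)"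
  \<comment> \<open>The three exchanges: maximum for smooth maximum, Poisson for Gaussian, smooth
    maximum for maximum. The centring lam m of the second one produces the term \<alpha> /
    2^K.\<close>
  have "real N * R = (real N * expected_ksat_max K N \<alpha> - T)
      + (T - gauss_mean (\<lambda>_. 0) 1 + \<alpha> * real N * (1 / 2 ^ K))
      + (gauss_mean (\<lambda>_. 0) 1 - real N * (sqrt \<alpha> / 2 ^ K * expected_pspin_max K N))"
    by (simp add: R_def algebra_simps)
  then have "\<bar>real N * R\<bar> \<le> real N * ln 2 / \<beta> + 4 * \<beta>\<^sup>2 * (\<alpha> * real N * (1 / 2 ^ K)) + real N * ln 2 / \<beta>"
    using 1 2 3 by argo
  also have "\<dots> = real N * (2 * ln 2 * (1 / \<beta>) + 4 * (\<beta>\<^sup>2 * \<alpha>) * (1 / 2 ^ K))"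
    by (simp add: algebra_simps)
  also have "\<dots> = real N * ((2 * ln 2 + 4 * (1 / 2 ^ K)) * \<alpha> powr (1 / 3))"
    unfolding inv sq by (simp add: algebra_simps)
  finally have "\<bar>R\<bar> \<le> (2 * ln 2 + 4 * (1 / 2 ^ K)) * \<alpha> powr (1 / 3)"
    using N by (simp add: abs_mult)
  also have "\<dots> \<le> 64 * \<alpha> powr (1 / 3)"
  proof (rule mult_right_mono)
    have "(1 :: real) / 2 ^ K \<le> 1" by simp
    moreover have "ln 2 \<le> (1 :: real)" using ln_le_minus_one[of 2] by simp
    ultimately show "2 * ln 2 + 4 * (1 / 2 ^ K) \<le> (64 :: real)" by linarith
  qed simp
  finally show ?thesis by (simp add: R_def)
qed

theorem theorem1:
  shows "\<exists>L>0. \<exists>R :: nat \<Rightarrow> nat \<Rightarrow> real \<Rightarrow> real.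
    \<forall>K\<ge>2. \<forall>N\<ge>1. \<forall>\<alpha>\<ge>L.
      expected_ksat_max K N \<alpha> =
        - (\<alpha> / 2 ^ K) + sqrt \<alpha> / 2 ^ K * expected_pspin_max K N + R K N \<alpha> \<and>
      \<bar>R K N \<alpha>\<bar> \<le> L * \<alpha> powr (1 / 3)"
proof (intro exI[of _ 64] conjI)
  define R where "R K N \<alpha> = expected_ksat_max K N \<alpha>
    - (- (\<alpha> / 2 ^ K) + sqrt \<alpha> / 2 ^ K * expected_pspin_max K N)" for K N \<alpha>
  show "\<exists>R :: nat \<Rightarrow> nat \<Rightarrow> real \<Rightarrow> real. \<forall>K\<ge>2. \<forall>N\<ge>1. \<forall>\<alpha>\<ge>64.
      expected_ksat_max K N \<alpha> =
        - (\<alpha> / 2 ^ K) + sqrt \<alpha> / 2 ^ K * expected_pspin_max K N + R K N \<alpha> \<and>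
      \<bar>R K N \<alpha>\<bar> \<le> 64 * \<alpha> powr (1 / 3)"
    using expected_ksat_max_bound by (intro exI[of _ R]) (auto simp: R_def)
qed simp

end
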